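(* Let $\alpha=\frac mn$ and $\beta=\frac pq$ with $m,n,p,q$ positive integers, $m\le n$, $p\le q$, and $\alpha\le\beta$. Let $a_1,a_2,b_1,b_2\in\mathbb{R}$, and consider the mixed index 2 problem $$D_t^{\alpha}y_1=a_1y_1+a_2y_2,\qquad D_t^{\beta}y_2=b_1y_1+b_2y_2,$$ with initial values $y_1(0),y_2(0)\in\mathbb{R}$. Put $N=mq+np$, $D_A=a_1b_2-a_2b_1$, $$\mathrm{Det}(z)=z^{mq+np}-a_1z^{np}-b_2z^{mq}+D_A,$$ let $\lambda_1,\dots,\lambda_N$ be the zeros of $\mathrm{Det}(z)$, so that $\mathrm{Det}(z)=\prod_{j=1}^N(z-\lambda_j)$, and let $$p_1(z)=y_1(0)z^{np}+a_2y_2(0)z^{np-mq}-b_2y_1(0),\qquad p_2(z)=y_2(0)z^{np}-a_1y_2(0)z^{np-mq}+b_1y_1(0).$$ Let $A_j^{(i)}$ be the coefficients in the partial fraction expansions $$\frac{p_i(z)}{\mathrm{Det}(z)}=\sum_{j=1}^N\frac{A_j^{(i)}}{z-\lambda_j},\qquad i=1,2,$$ and $A_j=(A_j^{(1)},A_j^{(2)})^\top$. Then the solution $y=(y_1,y_2)^\top$ is given by $$y(t)=\sum_{j=1}^{N}A_j\,E_{\frac1{nq},\,1-\alpha+\frac1{nq}}\!\left(\lambda_j t^{\frac1{nq}}\right).$$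
   Context: $D_t^\gamma$ denotes the Caputo derivative of order $\gamma\in(0,1]$ with starting point $0$: $D_t^{\gamma}u(t)=\frac{1}{\Gamma(1-\gamma)}\int_0^t\frac{u'(s)}{(t-s)^{\gamma}}\,ds$ for $0<\gamma<1$ and $D_t^1u=u'$. The generalised Mittag-Leffler function is $E_{\mu,\nu}(x)=\sum_{k=0}^\infty\frac{x^k}{\Gamma(\mu k+\nu)}$.
   Formalization: The printed formula lacks a factor: the formal statement has y(t) = t^{1/(nq)−α} Σ_j A_j E_{1/(nq),1−α+1/(nq)}(λ_j t^{1/(nq)}), asserted for t > 0; as printed it fails, e.g. α=β=1 with q=2 gives √t e^t instead of e^t. *)

theory Defs
  imports "HOL-Analysis.Analysis"
begin

text \<open>
  The Caputo derivative with starting point 0. The open interval is used because the derivative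
  of a typical solution is unbounded at 0. Both \<^const>\<open>deriv\<close> and the Lebesgue integral are
  total functions, so a genuine derivative also requires the companion predicate below.
\<close>

definition caputo_deriv :: "real \<Rightarrow> (real \<Rightarrow> real) \<Rightarrow> real \<Rightarrow> real" where
  "caputo_deriv \<gamma> u t =
     (if \<gamma> = 1 then deriv u t
      else 1 / Gamma (1 - \<gamma>) * (LINT s:{0<..<t}|lborel. deriv u s / (t - s) powr \<gamma>))"

definition caputo_differentiable :: "real \<Rightarrow> (real \<Rightarrow> real) \<Rightarrow> real \<Rightarrow> bool" where
  "caputo_differentiable \<gamma> u t \<longleftrightarrow>
     (if \<gamma> = 1 then u differentiable at t
      else (\<forall>s\<in>{0<..<t}. u differentiable at s) \<and>
           set_integrable lborel {0<..<t} (\<lambda>s. deriv u s / (t - s) powr \<gamma>))"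

text \<open>
  For \<open>\<mu>, \<nu> > 0\<close> the Laplace transform of \<open>t powr (\<nu> - 1) * E\<^bsub>\<mu>,\<nu>\<^esub>(\<lambda> * t powr \<mu>)\<close> is
  \<open>s powr (\<mu> - \<nu>) / (s powr \<mu> - \<lambda>)\<close>. The power of \<open>t\<close> in front of the Mittag-Leffler sum of the
  solution formula is this factor for \<open>\<mu> = 1/(nq)\<close> and \<open>\<nu> = 1 - \<alpha> + 1/(nq)\<close>; without it the formula
  fails in general when \<open>\<nu> \<noteq> 1\<close>.
\<close>

definition mittag_leffler :: "real \<Rightarrow> real \<Rightarrow> complex \<Rightarrow> complex" where
  "mittag_leffler \<mu> \<nu> x = (\<Sum>k. x ^ k / of_real (Gamma (\<mu> * real k + \<nu>)))"

text \<open>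
  A solution lives on the half-line from 0; values at negative arguments are irrelevant.
  The equations are imposed for positive times and are tied to the initial values by continuity
  at 0. (Without continuity the initial values would be unconstrained: the Caputo derivative does
  not depend on the value at 0.)
\<close>

definition mixed_index_solution ::
    "real \<Rightarrow> real \<Rightarrow> real \<Rightarrow> real \<Rightarrow> real \<Rightarrow> real \<Rightarrow> real \<Rightarrow> real \<Rightarrow>
     (real \<Rightarrow> real) \<Rightarrow> (real \<Rightarrow> real) \<Rightarrow> bool" where
  "mixed_index_solution \<alpha> \<beta> a1 a2 b1 b2 y10 y20 y1 y2 \<longleftrightarrow>
     y1 0 = y10 \<and> y2 0 = y20 \<and>
     continuous_on {0..} y1 \<and> continuous_on {0..} y2 \<and>
     (\<forall>t>0. caputo_differentiable \<alpha> y1 t \<and> caputo_differentiable \<beta> y2 t \<and>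
            caputo_deriv \<alpha> y1 t = a1 * y1 t + a2 * y2 t \<and>
            caputo_deriv \<beta> y2 t = b1 * y1 t + b2 * y2 t)"

end

theory Submission
  imports Defs
begin

text \<open>
  Put \<open>\<mu> = 1 / (n q)\<close>, \<open>K = m q\<close> and \<open>L = n p\<close>, so \<open>\<alpha> = \<mu> K\<close> and \<open>\<beta> = \<mu> L\<close>. By Cramer's rule the partial
  fractions satisfy \<open>(z\<^sup>K - a1) P1 - a2 P2 = y1(0)\<close> and \<open>(z\<^sup>L - b2) P2 - b1 P1 = y2(0) z\<^sup>L\<^sup>-\<^sup>K\<close>. Expanding
  at \<open>z = \<infinity>\<close>, the power sums \<open>c\<^sub>i k = (\<Sum>j. A\<^sub>i j * \<lambda>\<^sub>j ^ k)\<close> vanish for \<open>k < K - 1\<close>, start with the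
  initial values at \<open>k = K - 1\<close> and obey the recurrences \<open>c\<^sub>1 (k + K) = a1 c\<^sub>1 k + a2 c\<^sub>2 k\<close>,
  \<open>c\<^sub>2 (k + L) = b1 c\<^sub>1 k + b2 c\<^sub>2 k\<close>. Hence the Mittag-Leffler sums are real power series in \<open>t powr \<mu>\<close>
  with coefficients \<open>c\<^sub>i (l + K - 1) / \<Gamma>(\<mu> l + 1)\<close>, on which a Caputo derivative of order \<open>\<mu> K\<close> acts as
  the index shift by \<open>K\<close>; the recurrences say that they solve the system. Uniqueness: the Caputo
  equations imply weakly singular Volterra equations, and for large \<open>c\<close> the difference of two
  solutions is contracted in the norm \<open>sup exp (- c t) (\<bar>w1 t\<bar> + \<bar>w2 t\<bar>)\<close>.
\<close>

subsection \<open>Growth of the Gamma function and Beta kernels\<close>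

text \<open>Euler's integral is cut down to \<open>{T..}\<close>, where the power is at least its
  value at \<open>T\<close>. As \<open>T\<close> is free, Gamma eventually beats every geometric
  sequence.\<close>

lemma Gamma_ge_powr_exp:
  fixes x T :: real
  assumes x: "x \<ge> 1" and T: "T > 0"
  shows "T powr (x - 1) * exp (- T) \<le> Gamma x"
proof -
  have G: "((\<lambda>t. t powr (x - 1) / exp t) has_integral Gamma x) {0..}"
    using Gamma_integral_real[of x] x by simp
  have E: "((\<lambda>t. T powr (x - 1) * exp (- 1 * t)) has_integral T powr (x - 1) *
      (exp (- 1 * T) / 1)) {T..}"
    by (intro has_integral_mult_right has_integral_exp_minus_to_infinity) simp
  then have "((\<lambda>t. if t \<in> {T..} then T powr (x - 1) * exp (- 1 * t) else 0) has_integral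
      T powr (x - 1) * (exp (- 1 * T) / 1)) {0..}"
    using T by (subst has_integral_restrict) auto
  then have "T powr (x - 1) * (exp (- 1 * T) / 1) \<le> Gamma x"
  proof (rule has_integral_le[OF _ G])
    fix t :: real assume "t \<in> {0..}"
    then show "(if t \<in> {T..} then T powr (x - 1) * exp (- 1 * t) else 0) \<le> t powr (x - 1) / exp t"
      using T x by (auto simp: exp_minus divide_simps intro!: powr_mono2)
  qed
  then show ?thesis by simp
qed

text \<open>Taking \<open>T powr \<mu>\<close> as twice the growth rate leaves a majorant of ratio
  1/2. The scalar type is general so that the real series and the complex Mittag-Leffler series are
  both covered.\<close>

lemma summable_geometric_over_Gamma:
  fixes c :: "nat \<Rightarrow> 'a::{real_normed_field, banach}"
  assumes \<mu>: "\<mu> > 0" and R: "R > 0" and c: "\<And>k. norm (c k) \<le> C * R ^ k"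
  shows "summable (\<lambda>k. norm (c k / of_real (Gamma (\<mu> * real k + \<nu>)) * x ^ k))"
proof -
  define S where "S = R * norm x + 1"
  have S: "S > 0" using R by (simp add: S_def add_nonneg_pos)
  have C: "C \<ge> 0" using c[of 0] order_trans[OF norm_ge_zero] by auto
  define T where "T = (2 * S) powr (1 / \<mu>)"
  have T: "T > 0" using S by (simp add: T_def)
  have T\<mu>: "T powr \<mu> = 2 * S" using \<mu> S by (simp add: T_def powr_powr)
  define B where "B = C / (T powr (\<nu> - 1) * exp (- T))"
  \<comment> \<open>The lower bound for Gamma concerns arguments from 1 on; as \<open>\<nu>\<close>
    is arbitrary, finitely many terms are skipped.\<close>
  obtain k0 :: nat where k0: "real k0 > (1 - \<nu>) / \<mu>" using reals_Archimedean2 by blast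
  show ?thesis
  proof (rule summable_comparison_test'[of "\<lambda>k. B * (1 / 2) ^ k" k0])
    show "summable (\<lambda>k. B * (1 / 2 :: real) ^ k)"
      by (intro summable_mult summable_geometric) simp
    fix k assume "k0 \<le> k"
    then have "real k > (1 - \<nu>) / \<mu>" using k0 by linarith
    then have ge1: "\<mu> * real k + \<nu> \<ge> 1" using \<mu> by (simp add: divide_simps mult.commute)
    have "T powr (\<mu> * real k + \<nu> - 1) = T powr (\<nu> - 1) * (2 * S) ^ k"
    proof -
      have "T powr (\<mu> * real k + \<nu> - 1) = T powr (\<nu> - 1) * (T powr \<mu>) powr real k"
        by (simp add: powr_powr flip: powr_add) (simp add: algebra_simps)
      then show ?thesis using S T\<mu> by (simp add: powr_realpow)
    qed
    then have G: "T powr (\<nu> - 1) * exp (- T) * (2 * S) ^ k \<le> Gamma (\<mu> * real k + \<nu>)"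
      using Gamma_ge_powr_exp[OF ge1 T] by (simp add: mult_ac)
    have pos: "T powr (\<nu> - 1) * exp (- T) * (2 * S) ^ k > 0" using T S by simp
    have "norm (norm (c k / of_real (Gamma (\<mu> * real k + \<nu>)) * x ^ k))
        = norm (c k) * norm x ^ k / Gamma (\<mu> * real k + \<nu>)"
      using G pos by (simp add: norm_mult norm_divide norm_power)
    also have "\<dots> \<le> (C * R ^ k) * norm x ^ k / (T powr (\<nu> - 1) * exp (- T) * (2 * S) ^ k)"
      using c[of k] G pos C R by (intro frac_le mult_right_mono) auto
    also have "\<dots> = B * (R * norm x / (2 * S)) ^ k"
      by (simp add: B_def power_mult_distrib power_divide)
    also have "\<dots> \<le> B * (1 / 2) ^ k"
      using C T S R by (intro mult_left_mono power_mono) (auto simp: B_def S_def divide_simps)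
    finally show "norm (norm (c k / of_real (Gamma (\<mu> * real k + \<nu>)) * x ^ k)) \<le> B * (1 / 2) ^ k" .
  qed
qed

text \<open>The substitution \<open>s = r + (t - r) * x\<close> reduces both claims to Euler's Beta
  integral over the unit interval.\<close>

lemma
  fixes a b r t :: real
  assumes a: "a > 0" and b: "b > 0" and rt: "r < t"
  shows set_integrable_Beta_kernel:
      "set_integrable lborel {r<..<t} (\<lambda>s. (s - r) powr (a - 1) * (t - s) powr (b - 1))"
    and LINT_Beta_kernel:
      "(LINT s:{r<..<t}|lborel. (s - r) powr (a - 1) * (t - s) powr (b - 1)) = (t - r) powr
          (a + b - 1) * Beta a b"
proof -
  define f where "f s = indicator {r<..<t} s * ((s - r) powr (a - 1) * (t - s) powr (b - 1))"
      for s :: real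
  define g where "g x = indicator {0<..<1} x * (x powr (a - 1) * (1 - x) powr (b - 1))"
      for x :: real
  have "set_integrable lborel {0..1} (\<lambda>x. x powr (a - 1) * (1 - x) powr (b - 1))"
    using a b by (rule integrable_Beta)
  moreover have "integral {0..1} (\<lambda>x. x powr (a - 1) * (1 - x) powr (b - 1)) = Beta a b"
    using has_integral_Beta_real[OF a b] by (rule integral_unique)
  moreover have "AE x in lborel. indicator {0..1} x * (x powr (a - 1) * (1 - x) powr (b - 1)) = g x"
    using AE_lborel_singleton[of "0::real"] AE_lborel_singleton[of "1::real"]
    by eventually_elim (auto simp: g_def indicator_def)
  moreover have [measurable]: "g \<in> borel_measurable borel"
    unfolding g_def by measurable
  ultimately have g: "integrable lborel g" "integral\<^sup>L lborel g = Beta a b"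
    using set_borel_integral_eq_integral[of "{0..1}" "\<lambda>x. x powr (a - 1) * (1 - x) powr (b - 1)"]
      integrable_cong_AE[of "\<lambda>x. indicator {0..1} x * (x powr (a - 1) * (1 - x) powr
          (b - 1))" lborel g]
      integral_cong_AE[of "\<lambda>x. indicator {0..1} x * (x powr (a - 1) * (1 - x) powr
          (b - 1))" lborel g]
    by (auto simp: set_integrable_def set_lebesgue_integral_def)
  have fg: "f (r + (t - r) * x) = (t - r) powr (a + b - 2) * g x" for x
  proof -
    have 1: "r + (t - r) * x \<in> {r<..<t} \<longleftrightarrow> x \<in> {0<..<1}"
    proof -
      have "r + (t - r) * x < t \<longleftrightarrow> (t - r) * x < (t - r) * 1" by (simp add: less_diff_eq add.commute)
      then show ?thesis using rt by (auto simp: zero_less_mult_iff simp del: mult_1_right)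
    qed
    have 2: "t - (r + (t - r) * x) = (t - r) * (1 - x)" by (simp add: algebra_simps)
    have "((t - r) * x) powr (a - 1) * ((t - r) * (1 - x)) powr (b - 1) =
        (t - r) powr (a + b - 2) * (x powr (a - 1) * (1 - x) powr (b - 1))" if "x \<in> {0<..<1}"
    proof -
      have "(t - r) powr (a + b - 2) = (t - r) powr (a - 1) * (t - r) powr (b - 1)"
        by (simp flip: powr_add)
      then show ?thesis using that rt by (simp add: powr_mult)
    qed
    then show ?thesis using 1 2 by (auto simp: f_def g_def indicator_def)
  qed
  have "integrable lborel (\<lambda>x. f (r + (t - r) * x))" using g unfolding fg by simp
  then have "integrable lborel f"
    using rt lborel_integrable_real_affine_iff[of "t - r" f r] by simp
  then show "set_integrable lborel {r<..<t} (\<lambda>s. (s - r) powr (a - 1) * (t - s) powr (b - 1))"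
    by (simp add: set_integrable_def f_def[abs_def])
  have "integral\<^sup>L lborel f = (t - r) * ((t - r) powr (a + b - 2) * Beta a b)"
    using lborel_integral_real_affine[of "t - r" f r] rt g by (simp add: fg)
  also have "\<dots> = (t - r) powr (a + b - 1) * Beta a b"
    using rt powr_add[of "t - r" 1 "a + b - 2"] by simp
  finally show "(LINT s:{r<..<t}|lborel. (s - r) powr (a - 1) * (t - s) powr (b - 1)) =
      (t - r) powr (a + b - 1) * Beta a b"
    by (simp add: set_lebesgue_integral_def f_def[abs_def])
qed

lemma powr_kernel:
  fixes \<gamma> t :: real
  assumes \<gamma>: "\<gamma> > 0" and t: "t > 0"
  shows "set_integrable lborel {0<..<t} (\<lambda>s. (t - s) powr (\<gamma> - 1))"
    and "(LINT s:{0<..<t}|lborel. (t - s) powr (\<gamma> - 1)) = t powr \<gamma> * Beta 1 \<gamma>"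
proof -
  \<comment> \<open>This is the Beta kernel with \<open>a = 1\<close>: inside the interval the
    factor \<open>s powr 0\<close> is 1.\<close>
  have *: "(\<lambda>s. indicator {0<..<t} s *\<^sub>R ((t - s) powr (\<gamma> - 1)))
      = (\<lambda>s. indicator {0<..<t} s *\<^sub>R ((s - 0) powr (1 - 1) * (t - s) powr (\<gamma> - 1)))"
    by (auto simp: fun_eq_iff indicator_def)
  show "set_integrable lborel {0<..<t} (\<lambda>s. (t - s) powr (\<gamma> - 1))"
    using set_integrable_Beta_kernel[of 1 \<gamma> 0 t] \<gamma> t unfolding set_integrable_def * by simp
  show "(LINT s:{0<..<t}|lborel. (t - s) powr (\<gamma> - 1)) = t powr \<gamma> * Beta 1 \<gamma>"
    using LINT_Beta_kernel[of 1 \<gamma> 0 t] \<gamma> t unfolding set_lebesgue_integral_def * by simp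
qed

text \<open>A multiple of the bare kernel is an integrable majorant, since \<open>f\<close> is
  bounded on \<open>{0..t}\<close>. This permits subtracting the integral equations of two
  solutions.\<close>

lemma set_integrable_powr_kernel_mult:
  fixes f :: "real \<Rightarrow> real"
  assumes \<gamma>: "\<gamma> > 0" and t: "t > 0" and f: "continuous_on {0..} f"
  shows "set_integrable lborel {0<..<t} (\<lambda>s. (t - s) powr (\<gamma> - 1) * f s)"
proof -
  have fT: "continuous_on {0..t} f" using f by (rule continuous_on_subset) auto
  then have "bounded (f ` {0..t})"
    by (intro compact_imp_bounded compact_continuous_image) auto
  then obtain B where "\<forall>x\<in>f ` {0..t}. norm x \<le> B" unfolding bounded_iff by blast
  then have B: "\<bar>f s\<bar> \<le> B" if "s \<in> {0..t}" for s using that by auto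
  note k = powr_kernel(1)[OF \<gamma> t]
  show ?thesis unfolding set_integrable_def
  proof (rule Bochner_Integration.integrable_bound)
    show "integrable lborel (\<lambda>s. B * (indicator {0<..<t} s *\<^sub>R (t - s) powr (\<gamma> - 1)))"
      using k unfolding set_integrable_def by (rule integrable_mult_right)
    \<comment> \<open>Nothing is known about \<open>f\<close> at negative arguments, so
      measurability is only available after cutting off.\<close>
    have [measurable]: "(\<lambda>s. indicator {0..t} s *\<^sub>R f s) \<in> borel_measurable borel"
      using fT by (intro borel_measurable_continuous_on_indicator) auto
    have "(\<lambda>s. (indicator {0<..<t} s * (t - s) powr (\<gamma> - 1)) * (indicator {0..t} s *\<^sub>R f s)) \<in>
        borel_measurable lborel"
      by measurable
    also have "(\<lambda>s. (indicator {0<..<t} s * (t - s) powr (\<gamma> - 1)) * (indicator {0..t} s *\<^sub>R f s)) =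
      (\<lambda>s. indicator {0<..<t} s *\<^sub>R ((t - s) powr (\<gamma> - 1) * f s))"
      by (auto simp: fun_eq_iff indicator_def)
    finally show "(\<lambda>s. indicator {0<..<t} s *\<^sub>R ((t - s) powr (\<gamma> - 1) * f s)) \<in> borel_measurable
        lborel" .
    have "\<bar>f s\<bar> * (t - s) powr (\<gamma> - 1) \<le> \<bar>B\<bar> * (t - s) powr (\<gamma> - 1)" if "0 < s" "s < t" for s
      using B[of s] that by (intro mult_right_mono) auto
    then show "AE s in lborel. norm (indicator {0<..<t} s *\<^sub>R ((t - s) powr (\<gamma> - 1) * f s))
        \<le> norm (B * (indicator {0<..<t} s *\<^sub>R (t - s) powr (\<gamma> - 1)))"
      by (intro AE_I2) (auto simp: indicator_def abs_mult mult_ac)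
  qed
qed

subsection \<open>Power sums of partial fractions\<close>

text \<open>
  Substituting \<open>z = 1 / w\<close> and multiplying by \<open>w ^ K\<close> turns the hypothesis into an identity of
  power series in \<open>w\<close> near 0, since \<open>1 / (z - \<lambda>) = (\<Sum>k. \<lambda> ^ k * w ^ Suc k)\<close>.
\<close>

lemma partial_fraction_recurrence:
  fixes lam A B :: "nat \<Rightarrow> complex" and a b y :: complex
  assumes R: "R > 0" "\<And>j. j \<in> {1..N} \<Longrightarrow> norm (lam j) < R" and L: "0 < L" "L \<le> K"
    and eq: "\<And>z. norm z > R \<Longrightarrow>
      (z ^ K - a) * (\<Sum>j=1..N. A j / (z - lam j)) - b * (\<Sum>j=1..N. B j / (z - lam j)) = y * z ^
          (K - L)"
  defines "\<And>k. cA k \<equiv> \<Sum>j=1..N. A j * lam j ^ k" and "\<And>k. cB k \<equiv> \<Sum>j=1..N. B j * lam j ^ k"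
  shows "cA (k + K) = a * cA k + b * cB k"
    and "k < K \<Longrightarrow> cA k = (if Suc k = L then y else 0)"
proof -
  \<comment> \<open>\<open>F A\<close> is the generating function of the power sums, the expansion
    at 0 of \<open>\<Sum>j=1..N. A j / (1 - lam j * w)\<close>.\<close>
  define F where "F A = Abs_fps (\<lambda>k. \<Sum>j=1..N. A j * lam j ^ k)" for A :: "nat \<Rightarrow> complex"
  have F_sums: "(\<lambda>k. fps_nth (F A) k * w ^ k) sums (\<Sum>j=1..N. A j / (1 - lam j * w))"
    if "norm w < 1 / R" for A w
  proof -
    have "(\<lambda>k. \<Sum>j=1..N. A j * (lam j * w) ^ k) sums (\<Sum>j=1..N. A j * (1 / (1 - lam j * w)))"
    proof (intro sums_sum sums_mult geometric_sums)
      fix j assume j: "j \<in> {1..N}"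
      have "norm (lam j * w) \<le> R * norm w"
        using R(2)[OF j] by (simp add: norm_mult mult_right_mono)
      also have "\<dots> < 1" using that R by (simp add: field_simps)
      finally show "norm (lam j * w) < 1" .
    qed
    then show ?thesis by (simp add: F_def sum_distrib_right power_mult_distrib mult.assoc)
  qed
  have ev: "eval_fps (F A) w = (\<Sum>j=1..N. A j / (1 - lam j * w))" if "norm w < 1 / R" for A w
    using F_sums[OF that] by (simp add: eval_fps_def sums_iff)
  \<comment> \<open>Half of \<open>1 / R\<close> is used because convergence is known only at points
    strictly inside that disc.\<close>
  have rad: "fps_conv_radius (F A) \<ge> 1 / (2 * R)" for A
    unfolding fps_conv_radius_def
    using F_sums[of "of_real (1 / (2 * R))" A] R
      conv_radius_geI[of "fps_nth (F A)" "of_real (1 / (2 * R))"]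
    by (auto simp: sums_iff norm_divide field_simps)
  have Rpos: "ereal (1 / (2 * R)) > 0" using R by simp
  let ?X = "fps_X :: complex fps"
  \<comment> \<open>With \<open>w = 1 / z\<close>, the identity \<open>?l = ?r\<close> is the
    hypothesis times \<open>w ^ K\<close>: each partial fraction sum is \<open>w\<close> times its
    generating function, and \<open>y * z ^ (K - L)\<close> becomes
    \<open>y * w ^ L\<close>.\<close>
  let ?l = "(1 - fps_const a * ?X ^ K) * (?X * F A) - fps_const b * ?X ^ K * (?X * F B)"
  let ?r = "fps_const y * ?X ^ L"
  have mr: "r \<le> fps_conv_radius f \<Longrightarrow> r \<le> fps_conv_radius g \<Longrightarrow> r \<le> fps_conv_radius (f * g)"
    for f g :: "complex fps" and r
    using fps_conv_radius_mult[of f g] by (meson min.boundedI order_trans)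
  have dr: "r \<le> fps_conv_radius f \<Longrightarrow> r \<le> fps_conv_radius g \<Longrightarrow> r \<le> fps_conv_radius (f - g)"
    for f g :: "complex fps" and r
    using fps_conv_radius_diff[of f g] by (meson min.boundedI order_trans)
  let ?rr = "ereal (1 / (2 * R))"
  have XK: "fps_conv_radius (?X ^ K) = \<infinity>" for K
    using fps_conv_radius_power[of ?X K] by simp
  have r1: "?rr \<le> fps_conv_radius (fps_const c * ?X ^ K)" for c K
    by (intro mr) (simp_all add: XK)
  have r2: "?rr \<le> fps_conv_radius (1 - fps_const a * ?X ^ K)"
    by (intro dr r1) simp
  have r3: "?rr \<le> fps_conv_radius (?X * F A)" for A
    by (intro mr) (simp_all add: rad)
  have "?l = ?r"
  proof (rule eval_fps_eqD)
    have "?rr \<le> fps_conv_radius ?l"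
      by (rule dr; rule mr; rule r1 r2 r3)
    then show "fps_conv_radius ?l > 0" "fps_conv_radius ?r > 0"
      using less_le_trans[OF Rpos] r1 by auto
    have "eventually (\<lambda>w::complex. w \<in> ball 0 (1 / (2 * R))) (nhds 0)"
      using R by (intro eventually_nhds_in_open) auto
    then have "eventually (\<lambda>w::complex. norm w < 1 / (2 * R)) (nhds 0)" by simp
    then show "eventually (\<lambda>w. eval_fps ?l w = eval_fps ?r w) (nhds 0)"
    proof eventually_elim
      case (elim w)
      have w: "norm w < 1 / R" using elim R by (simp add: field_simps)
      have wr: "ereal (norm w) < f" if "?rr \<le> f" for f
        using elim that by (metis less_ereal.simps(1) less_le_trans)
      have "eval_fps ?l w = (1 - a * w ^ K) * (w * eval_fps (F A) w) - b * w ^ K * (w * eval_fps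
          (F B) w)"
        using wr r1 r2 r3 rad XK
        by (simp add: eval_fps_diff eval_fps_mult eval_fps_power mr)
      also have "\<dots> = y * w ^ L"
      \<comment> \<open>At \<open>w = 0\<close> both sides vanish, as \<open>L > 0\<close>;
        elsewhere the hypothesis applies at \<open>z = 1 / w\<close>.\<close>
      proof (cases "w = 0")
        case False
        define z where "z = 1 / w"
        have z: "norm z > R" using w False R by (simp add: z_def norm_divide field_simps)
        have tr: "w * (C j / (1 - lam j * w)) = C j / (z - lam j)" for C j
          using False by (simp add: z_def divide_simps)
        then have S: "w * (\<Sum>j=1..N. C j / (1 - lam j * w)) = (\<Sum>j=1..N. C j / (z - lam j))" for C
          by (simp only: sum_distrib_left)
        have "w ^ K * ((z ^ K - a) * (\<Sum>j=1..N. A j / (z - lam j)) - b * (\<Sum>j=1..N. B j /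
            (z - lam j)))
            = (1 - a * w ^ K) * (\<Sum>j=1..N. A j / (z - lam j)) - b * w ^ K * (\<Sum>j=1..N. B j /
                (z - lam j))"
          using False by (simp add: z_def power_divide field_simps)
        moreover have "w ^ K * (y * z ^ (K - L)) = y * w ^ L"
          using L False by (simp add: z_def power_divide power_diff)
        ultimately show ?thesis
          using eq[OF z] by (simp only: ev[OF w] S)
      qed (use L in auto)
      also have "\<dots> = eval_fps ?r w" by (simp add: eval_fps_mult eval_fps_power XK)
      finally show ?case .
    qed
  qed
  then have "fps_nth ?l (Suc i) = fps_nth ?r (Suc i)" for i by simp
  note nth = this
  \<comment> \<open>The factor \<open>?X\<close> in front of \<open>F A\<close> makes
    \<open>Suc i\<close> the place of the power sum with index \<open>i\<close>. At
    \<open>Suc i = K\<close> the shifted product contributes a vanishing constant coefficient, so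
    the cut-off is \<open>i < K\<close>.\<close>
  have co: "cA i - (if i < K then 0 else a * cA (i - K)) - (if i < K then 0 else b * cB (i - K))
     = (if Suc i = L then y else 0)" for i
    using nth[of i] L
    by (cases "Suc i" K rule: linorder_cases)
      (auto simp: F_def cA_def cB_def left_diff_distrib mult.assoc fps_X_power_mult_nth Suc_diff_le)
  show "cA (k + K) = a * cA k + b * cB k" using co[of "k + K"] L by (auto simp: algebra_simps)
  show "k < K \<Longrightarrow> cA k = (if Suc k = L then y else 0)" using co[of k] by simp
qed

subsection \<open>Uniqueness\<close>

text \<open>
  The Caputo equation is the Abel equation \<open>I\<^sup>1\<^sup>-\<^sup>\<gamma> u' = f\<close>. Applying \<open>I\<^sup>\<gamma>\<close> and exchanging the
  integrals, the inner kernel is a Beta integral independent of the integration limits, which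
  leaves \<open>\<integral> u'\<close>.
\<close>

lemma caputo_imp_integral_equation:
  fixes u f :: "real \<Rightarrow> real"
  assumes \<gamma>: "0 < \<gamma>" "\<gamma> \<le> 1" and u: "continuous_on {0..} u"
    and cd: "\<And>t. t > 0 \<Longrightarrow> caputo_differentiable \<gamma> u t"
    and cf: "\<And>t. t > 0 \<Longrightarrow> caputo_deriv \<gamma> u t = f t"
    and f: "continuous_on {0..} f" and t: "t > 0"
  shows "(LINT s:{0<..<t}|lborel. (t - s) powr (\<gamma> - 1) * f s) = Gamma \<gamma> * (u t - u 0)"
proof (cases "\<gamma> = 1")
  case True
  \<comment> \<open>For \<open>\<gamma> = 1\<close> the kernel is 1 inside the interval, and the
    claim is the fundamental theorem of calculus.\<close>
  have "(f has_integral u t - u 0) {0..t}"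
  proof (rule fundamental_theorem_of_calculus_interior)
    show "continuous_on {0..t} u" using u by (rule continuous_on_subset) auto
    show "(u has_vector_derivative f x) (at x)" if "x \<in> {0<..<t}" for x
      using cd[of x] cf[of x] that True DERIV_deriv_iff_real_differentiable[of u x]
      by (auto simp: caputo_differentiable_def caputo_deriv_def
          has_real_derivative_iff_has_vector_derivative[symmetric])
  qed (use t in simp)
  moreover have "set_integrable lborel {0..t} f"
    by (rule borel_integrable_atLeastAtMost') (use f continuous_on_subset in fastforce)
  ultimately have "(LINT s:{0..t}|lborel. f s) = u t - u 0"
    using set_borel_integral_eq_integral(2)[of "{0..t}" f] by (simp add: integral_unique)
  moreover have "(LINT s:{0..t}|lborel. f s) = (LINT s:{0<..<t}|lborel. (t - s) powr (\<gamma> - 1) * f s)"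
    unfolding set_lebesgue_integral_def
  proof (rule integral_cong_AE)
    show "AE s in lborel. indicat_real {0..t} s *\<^sub>R f s = indicat_real {0<..<t} s *\<^sub>R
        ((t - s) powr (\<gamma> - 1) * f s)"
      using AE_lborel_singleton[of "0::real"] AE_lborel_singleton[of t]
      by eventually_elim (auto simp: indicator_def True)
  next
    have *: "(\<lambda>s. indicator {0..t} s *\<^sub>R f s) \<in> borel_measurable borel"
      using f by (intro borel_measurable_continuous_on_indicator) (auto intro: continuous_on_subset)
    then show "(\<lambda>s. indicator {0..t} s *\<^sub>R f s) \<in> borel_measurable lborel" by simp
    have "(\<lambda>s. (indicator {0<..<t} s * (t - s) powr (\<gamma> - 1)) * (indicator {0..t} s *\<^sub>R f s)) \<in>
        borel_measurable lborel"
      using * by simp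
    also have "(\<lambda>s. (indicator {0<..<t} s * (t - s) powr (\<gamma> - 1)) * (indicator {0..t} s *\<^sub>R f s)) =
      (\<lambda>s. indicator {0<..<t} s *\<^sub>R ((t - s) powr (\<gamma> - 1) * f s))"
      by (auto simp: fun_eq_iff indicator_def)
    finally show "(\<lambda>s. indicator {0<..<t} s *\<^sub>R ((t - s) powr (\<gamma> - 1) * f s)) \<in> borel_measurable
        lborel" .
  qed
  ultimately show ?thesis by (simp add: True)
next
  case False
  with \<gamma> have \<gamma>1: "\<gamma> < 1" by simp
  then have \<Gamma>: "Gamma (1 - \<gamma>) > 0" by (intro Gamma_real_pos) simp
  define g where "g = deriv u"
  have gint: "set_integrable lborel {0<..<s} (\<lambda>r. g r / (s - r) powr \<gamma>)" if "s > 0" for s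
    using cd[OF that] \<gamma>1 by (simp add: caputo_differentiable_def g_def)
  have gf: "f s = 1 / Gamma (1 - \<gamma>) * (LINT r:{0<..<s}|lborel. g r / (s - r) powr \<gamma>)" if "s > 0"
      for s
    using cf[OF that] \<gamma>1 by (simp add: caputo_deriv_def g_def)
  define G where "G r = indicator {0<..<t} r * g r" for r
  \<comment> \<open>Measurability of \<open>deriv u\<close> on the interval is extracted from the
    assumed integrability by multiplying the weight back.\<close>
  have Gm: "G \<in> borel_measurable borel"
  proof -
    have "(\<lambda>r. (t - r) powr \<gamma> * (indicator {0<..<t} r *\<^sub>R (g r / (t - r) powr \<gamma>))) \<in>
        borel_measurable lborel"
      using gint[OF t] borel_measurable_integrable unfolding set_integrable_def
      by (intro borel_measurable_times) auto
    also have "(\<lambda>r. (t - r) powr \<gamma> * (indicator {0<..<t} r *\<^sub>R (g r / (t - r) powr \<gamma>))) = G"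
      by (auto simp: fun_eq_iff G_def indicator_def)
    finally show ?thesis by simp
  qed
  note [measurable] = Gm
  \<comment> \<open>Since \<open>(t - r) powr \<gamma>\<close> is at most
    \<open>t powr \<gamma>\<close>, integrability against the singular weight implies plain
    integrability.\<close>
  have Gi: "integrable lborel G"
  proof (rule Bochner_Integration.integrable_bound)
    show "integrable lborel (\<lambda>r. t powr \<gamma> * (indicator {0<..<t} r *\<^sub>R (g r / (t - r) powr \<gamma>)))"
      using gint[OF t] unfolding set_integrable_def by (rule integrable_mult_right)
    have "\<bar>g r\<bar> \<le> t powr \<gamma> * (\<bar>g r\<bar> / (t - r) powr \<gamma>)" if "0 < r" "r < t" for r
    proof -
      have "(t - r) powr \<gamma> \<le> t powr \<gamma>" using that \<gamma> by (intro powr_mono2) auto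
      then have "\<bar>g r\<bar> * (t - r) powr \<gamma> \<le> \<bar>g r\<bar> * t powr \<gamma>" by (rule mult_left_mono) simp
      then show ?thesis using that by (simp add: field_simps)
    qed
    then show "AE r in lborel. norm (G r) \<le> norm (t powr \<gamma> * (indicator {0<..<t} r *\<^sub>R
        (g r / (t - r) powr \<gamma>)))"
      by (intro AE_I2) (auto simp: G_def indicator_def abs_mult)
  qed simp
  have intG: "integral\<^sup>L lborel G = u t - u 0"
  proof -
    \<comment> \<open>The interior form of the fundamental theorem allows the derivative to blow up
      at 0, where \<open>u\<close> is merely continuous.\<close>
    have "(g has_integral u t - u 0) {0..t}"
    proof (rule fundamental_theorem_of_calculus_interior)
      show "continuous_on {0..t} u" using u by (rule continuous_on_subset) auto
      show "(u has_vector_derivative g x) (at x)" if "x \<in> {0<..<t}" for x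
        using cd[OF t] that \<gamma>1
        by (auto simp: caputo_differentiable_def g_def DERIV_deriv_iff_real_differentiable
            has_real_derivative_iff_has_vector_derivative[symmetric])
    qed (use t in simp)
    then have "(g has_integral u t - u 0) {0<..<t}"
      by (subst (asm) has_integral_Icc_iff_Ioo)
    moreover have "set_integrable lborel {0<..<t} g"
      using Gi by (simp add: set_integrable_def G_def[abs_def])
    ultimately show ?thesis
      using set_borel_integral_eq_integral(2)[of "{0<..<t}" g]
      by (simp add: integral_unique set_lebesgue_integral_def G_def[abs_def])
  qed
  \<comment> \<open>\<open>k\<close> carries the triangle \<open>r < s < t\<close>. Its integral
    over \<open>s\<close> has Beta parameters \<open>1 - \<gamma>\<close> and
    \<open>\<gamma>\<close> with sum 1, hence the same value for all \<open>r < t\<close>.\<close>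
  define k where "k r s = indicator {r<..<t} s * ((s - r) powr (- \<gamma>) * (t - s) powr (\<gamma> - 1))"
      for r s
  have k_nonneg: "k r s \<ge> 0" for r s by (simp add: k_def)
  have km[measurable]: "(\<lambda>p. k (fst p) (snd p)) \<in> borel_measurable (lborel \<Otimes>\<^sub>M lborel)"
  proof -
    have "(\<lambda>p::real\<times>real. (if fst p < snd p \<and> snd p < t then (snd p - fst p) powr (- \<gamma>) *
        (t - snd p) powr (\<gamma> - 1) else 0))
       \<in> borel_measurable (lborel \<Otimes>\<^sub>M lborel)" by measurable
    also have "(\<lambda>p::real\<times>real. (if fst p < snd p \<and> snd p < t then (snd p - fst p) powr (- \<gamma>) *
        (t - snd p) powr (\<gamma> - 1) else 0))
       = (\<lambda>p. k (fst p) (snd p))" by (auto simp: k_def fun_eq_iff)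
    finally show ?thesis .
  qed
  have ki: "integrable lborel (k r)" and kI: "integral\<^sup>L lborel (k r) = Gamma (1 - \<gamma>) * Gamma \<gamma>"
      if "r < t" for r
    using set_integrable_Beta_kernel[of "1 - \<gamma>" \<gamma> r t] LINT_Beta_kernel[of "1 - \<gamma>" \<gamma> r t] that \<gamma> \<gamma>1
    by (simp_all add: set_integrable_def set_lebesgue_integral_def k_def[abs_def] Beta_def)
  define F where "F = (\<lambda>(r, s). G r * k r s)"
  have Fm: "F \<in> borel_measurable (lborel \<Otimes>\<^sub>M lborel)"
    unfolding F_def split_beta by measurable
  have Fs: "integral\<^sup>L lborel (\<lambda>s. G r * k r s) = Gamma (1 - \<gamma>) * Gamma \<gamma> * G r"
      "integral\<^sup>L lborel (\<lambda>s. \<bar>G r\<bar> * k r s) = Gamma (1 - \<gamma>) * Gamma \<gamma> * \<bar>G r\<bar>"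
      "integrable lborel (\<lambda>s. G r * k r s)" for r
    using ki[of r] kI[of r] by (cases "r < t"; auto simp: G_def)+
  have Fi: "integrable (lborel \<Otimes>\<^sub>M lborel) (\<lambda>(r, s). G r * k r s)"
    unfolding F_def[symmetric]
  proof (rule lborel_pair.Fubini_integrable[OF Fm])
    show "integrable lborel (\<lambda>r. \<integral> s. norm (F (r, s)) \<partial>lborel)"
      using Gi by (simp only: F_def prod.case real_norm_def abs_mult abs_of_nonneg[OF k_nonneg]
          Fs(2))
        (intro integrable_mult_right integrable_abs)
    show "AE r in lborel. integrable lborel (\<lambda>s. F (r, s))" by
        (simp only: F_def prod.case Fs(3)) simp
  qed
  \<comment> \<open>Integrating over \<open>r\<close> first recovers the Caputo integral at
    \<open>s\<close>, that is, \<open>f s\<close> up to a constant and the outer kernel.\<close>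
  have inner: "(\<integral> r. G r * k r s \<partial>lborel) = indicator {0<..<t} s * ((t - s) powr (\<gamma> - 1) *
      (Gamma (1 - \<gamma>) * f s))" for s
  proof (cases "s \<in> {0<..<t}")
    case True
    have "G r * k r s = (t - s) powr (\<gamma> - 1) * (indicator {0<..<s} r *\<^sub>R
        (g r / (s - r) powr \<gamma>))" for r
      using True by (auto simp: G_def k_def indicator_def powr_minus divide_simps)
    then have "(\<integral> r. G r * k r s \<partial>lborel) = (t - s) powr (\<gamma> - 1) *
        (LINT r:{0<..<s}|lborel. g r / (s - r) powr \<gamma>)"
      by (simp only: set_lebesgue_integral_def integral_mult_right_zero)
    also have "(LINT r:{0<..<s}|lborel. g r / (s - r) powr \<gamma>) = Gamma (1 - \<gamma>) * f s"
      using gf[of s] True \<Gamma> by simp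
    finally show ?thesis using True by simp
  next
    case False
    then have "G r * k r s = 0" for r by (auto simp: G_def k_def indicator_def)
    then show ?thesis using False by (simp only:) simp
  qed
  have "Gamma (1 - \<gamma>) * (LINT s:{0<..<t}|lborel. (t - s) powr (\<gamma> - 1) * f s) =
      (\<integral> s. (\<integral> r. G r * k r s \<partial>lborel) \<partial>lborel)"
    unfolding inner by (simp add: set_lebesgue_integral_def mult_ac flip: integral_mult_right_zero)
  also have "\<dots> = (\<integral> r. (\<integral> s. G r * k r s \<partial>lborel) \<partial>lborel)"
    using Fi by (rule lborel_pair.Fubini_integral)
  also have "\<dots> = Gamma (1 - \<gamma>) * (Gamma \<gamma> * (u t - u 0))"
    by (simp only: Fs(1)) (simp add: intG)
  finally show ?thesis using \<Gamma> by simp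
qed

text \<open>
  The estimate \<open>exp (- x) \<le> x powr (- \<gamma> / 2)\<close>, applied to \<open>x = L * (t - s)\<close>, gives up half of the
  integrability exponent of the kernel in exchange for decay in \<open>L\<close>.
\<close>

lemma weighted_kernel_bound:
  fixes h :: "real \<Rightarrow> real"
  assumes \<gamma>: "0 < \<gamma>" "\<gamma> \<le> 1" and L: "L > 0" and t: "0 < t"
    and h: "\<And>s. 0 < s \<Longrightarrow> s < t \<Longrightarrow> \<bar>h s\<bar> \<le> B * exp (L * s)"
    and B: "B \<ge> 0"
  shows "\<bar>LINT s:{0<..<t}|lborel. (t - s) powr (\<gamma> - 1) * h s\<bar> \<le> B * exp (L * t) *
      (L powr (- \<gamma> / 2) * (t powr (\<gamma> / 2) * Beta 1 (\<gamma> / 2)))"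
proof -
  define k where "k s = indicator {0<..<t} s * ((t - s) powr (\<gamma> / 2 - 1))" for s
  have k: "integrable lborel k" "integral\<^sup>L lborel k = t powr (\<gamma> / 2) * Beta 1 (\<gamma> / 2)"
    using powr_kernel[of "\<gamma> / 2" t] \<gamma> t
    by (simp_all add: set_integrable_def set_lebesgue_integral_def k_def[abs_def])
  have exp_le: "exp (- x) \<le> x powr (- \<gamma> / 2)" if "x > 0" for x :: real
  proof (cases "x \<ge> 1")
    case True
    have x: "x \<le> exp x" using exp_ge_add_one_self[of x] by linarith
    have "exp (- x) \<le> 1 / x" using x that by (simp add: exp_minus divide_simps)
    also have "1 / x = x powr (- 1)" using that by (simp add: powr_minus_divide)
    also have "\<dots> \<le> x powr (- \<gamma> / 2)" using True \<gamma> by (intro powr_mono) auto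
    finally show ?thesis .
  next
    case False
    have "exp (- x) \<le> 1" using that by simp
    also have "\<dots> = x powr 0" using that by simp
    also have "\<dots> \<le> x powr (- \<gamma> / 2)" using False that \<gamma> by (intro powr_mono') auto
    finally show ?thesis .
  qed
  let ?K = "\<lambda>s. indicator {0<..<t} s *\<^sub>R ((t - s) powr (\<gamma> - 1) * h s)"
  have Kk: "\<bar>?K s\<bar> \<le> (B * exp (L * t) * L powr (- \<gamma> / 2)) * k s" for s
  proof -
    have "(t - s) powr (\<gamma> - 1) * \<bar>h s\<bar> \<le> B * exp (L * t) * L powr (- \<gamma> / 2) * (t - s) powr
        (\<gamma> / 2 - 1)"
      if s: "0 < s" "s < t"
    proof -
      have "\<bar>h s\<bar> \<le> B * exp (L * s)" using h s by simp
      also have "exp (L * s) = exp (L * t) * exp (- (L * (t - s)))" by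
          (simp add: algebra_simps flip: exp_add)
      also have "\<dots> \<le> exp (L * t) * (L * (t - s)) powr (- \<gamma> / 2)"
        using exp_le[of "L * (t - s)"] L s by simp
      also have "(L * (t - s)) powr (- \<gamma> / 2) = L powr (- \<gamma> / 2) * (t - s) powr (- \<gamma> / 2)"
        using L s by (simp add: powr_mult)
      finally have "\<bar>h s\<bar> \<le> B * (exp (L * t) * (L powr (- \<gamma> / 2) * (t - s) powr (- \<gamma> / 2)))"
        using B by (simp add: mult_left_mono)
      from mult_left_mono[OF this, of "(t - s) powr (\<gamma> - 1)"]
      have "(t - s) powr (\<gamma> - 1) * \<bar>h s\<bar> \<le> B * exp (L * t) * L powr (- \<gamma> / 2) * ((t - s) powr
          (\<gamma> - 1) * (t - s) powr (- \<gamma> / 2))"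
        by (simp add: mult_ac)
      also have "(t - s) powr (\<gamma> - 1) * (t - s) powr (- \<gamma> / 2) = (t - s) powr (\<gamma> / 2 - 1)"
        by (simp flip: powr_add)
      finally show ?thesis .
    qed
    then show ?thesis by (auto simp: k_def indicator_def abs_mult)
  qed
  have "\<bar>integral\<^sup>L lborel ?K\<bar> \<le> (\<integral>s. (B * exp (L * t) * L powr (- \<gamma> / 2)) * k s \<partial>lborel)"
  proof (cases "integrable lborel ?K")
    case True
    have "\<bar>integral\<^sup>L lborel ?K\<bar> \<le> (\<integral>s. \<bar>?K s\<bar> \<partial>lborel)" by (rule integral_abs_bound)
    also have "\<dots> \<le> (\<integral>s. (B * exp (L * t) * L powr (- \<gamma> / 2)) * k s \<partial>lborel)"
      using True k Kk by (intro integral_mono) auto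
    finally show ?thesis .
  next
    \<comment> \<open>\<open>h\<close> is not assumed measurable. If the integral fails to exist,
      its value is 0 by convention and the bound is trivial.\<close>
    case False
    have "(\<integral>s. (B * exp (L * t) * L powr (- \<gamma> / 2)) * k s \<partial>lborel) \<ge> 0"
      using Kk by (intro integral_nonneg_AE AE_I2) (meson abs_ge_zero order_trans)
    then show ?thesis by (simp only: not_integrable_integral_eq[OF False] abs_zero)
  qed
  also have "\<dots> = B * exp (L * t) * (L powr (- \<gamma> / 2) * (t powr (\<gamma> / 2) * Beta 1 (\<gamma> / 2)))"
    by (simp add: k)
  finally show ?thesis by (simp add: set_lebesgue_integral_def)
qed

text \<open>At a maximum point \<open>t0\<close> of the weighted function on \<open>{0..T}\<close>,
  each equation with \<open>L\<close> large bounds its component by less than half of the total,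
  unless the maximum is 0.\<close>

lemma abel_system_unique:
  fixes w1 w2 :: "real \<Rightarrow> real"
  assumes \<alpha>: "0 < \<alpha>" "\<alpha> \<le> 1" and \<beta>: "0 < \<beta>" "\<beta> \<le> 1"
    and c: "continuous_on {0..} w1" "continuous_on {0..} w2" and w0: "w1 0 = 0" "w2 0 = 0"
    and e1: "\<And>t. t > 0 \<Longrightarrow> (LINT s:{0<..<t}|lborel. (t - s) powr (\<alpha> - 1) *
        (a1 * w1 s + a2 * w2 s)) = Gamma \<alpha> * w1 t"
    and e2: "\<And>t. t > 0 \<Longrightarrow> (LINT s:{0<..<t}|lborel. (t - s) powr (\<beta> - 1) *
        (b1 * w1 s + b2 * w2 s)) = Gamma \<beta> * w2 t"
    and t: "T > 0"
  shows "w1 T = 0 \<and> w2 T = 0"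
proof -
  define A where "A = \<bar>a1\<bar> + \<bar>a2\<bar> + \<bar>b1\<bar> + \<bar>b2\<bar>"
  \<comment> \<open>The contraction factor contains \<open>T\<close> instead of the maximum point,
    because that point depends on \<open>L\<close> and \<open>L\<close> is chosen first.\<close>
  define q where "q \<gamma> L = A * (L powr (- \<gamma> / 2) * (T powr (\<gamma> / 2) * Beta 1 (\<gamma> / 2))) / Gamma \<gamma>"
      for \<gamma> L
  have q0: "eventually (\<lambda>L. q \<gamma> L < 1 / 2) at_top" if "\<gamma> > 0" for \<gamma>
  proof -
    have "((\<lambda>L. q \<gamma> L) \<longlongrightarrow> A * (0 * (T powr (\<gamma> / 2) * Beta 1 (\<gamma> / 2))) / Gamma \<gamma>) at_top"
      unfolding q_def using that less_imp_neq[OF Gamma_real_pos[OF that]]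
      by (intro tendsto_intros tendsto_neg_powr filterlim_ident) auto
    then show ?thesis by (rule order_tendstoD) simp
  qed
  from eventually_happens[OF eventually_conj[OF eventually_conj[OF q0[OF \<alpha>(1)] q0[OF \<beta>(1)]]
      eventually_gt_at_top[of 0]]]
  obtain L where L: "q \<alpha> L < 1 / 2" "q \<beta> L < 1 / 2" "L > 0" by auto
  define f where "f s = exp (- L * s) * (\<bar>w1 s\<bar> + \<bar>w2 s\<bar>)" for s
  have "continuous_on {0..T} f"
    unfolding f_def by (intro continuous_intros continuous_on_subset[OF c(1)]
        continuous_on_subset[OF c(2)]) auto
  then obtain t0 where t0: "t0 \<in> {0..T}" and max: "\<And>s. s \<in> {0..T} \<Longrightarrow> f s \<le> f t0"
    using continuous_attains_sup[of "{0..T}" f] t by auto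
  have f0: "f s \<ge> 0" for s by (simp add: f_def)
  have wle: "\<bar>w1 s\<bar> + \<bar>w2 s\<bar> \<le> f t0 * exp (L * s)" if "s \<in> {0..T}" for s
    using max[OF that] by (simp add: f_def exp_minus divide_simps)
  have lin: "\<bar>a * w1 s + b * w2 s\<bar> \<le> (A * f t0) * exp (L * s)" if "s \<in> {0..T}" "\<bar>a\<bar> \<le> A" "\<bar>b\<bar>
      \<le> A" for s a b
  proof -
    have "\<bar>a * w1 s + b * w2 s\<bar> \<le> \<bar>a\<bar> * \<bar>w1 s\<bar> + \<bar>b\<bar> * \<bar>w2 s\<bar>"
      using abs_triangle_ineq[of "a * w1 s" "b * w2 s"] by (simp add: abs_mult)
    also have "\<dots> \<le> A * \<bar>w1 s\<bar> + A * \<bar>w2 s\<bar>" using that by (intro add_mono mult_right_mono) auto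
    also have "\<dots> = A * (\<bar>w1 s\<bar> + \<bar>w2 s\<bar>)" by (simp add: distrib_left)
    also have "\<dots> \<le> A * (f t0 * exp (L * s))" using wle[OF that(1)] by (intro mult_left_mono)
        (auto simp: A_def)
    finally show ?thesis by (simp add: mult.assoc)
  qed
  have step: "\<bar>w t0\<bar> \<le> (f t0 * exp (L * t0)) * q \<gamma> L"
    if "t0 > 0" and \<gamma>: "0 < \<gamma>" "\<gamma> \<le> 1" "\<bar>a\<bar> \<le> A" "\<bar>b\<bar> \<le> A"
      and e: "\<And>t. t > 0 \<Longrightarrow> (LINT s:{0<..<t}|lborel. (t - s) powr (\<gamma> - 1) * (a * w1 s + b * w2 s))
          = Gamma \<gamma> * w t"
    for \<gamma> a b w
  proof -
    have G: "Gamma \<gamma> > 0" using \<gamma> by (intro Gamma_real_pos)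
    have Bp: "Beta 1 (\<gamma> / 2) \<ge> 0" using \<gamma> by (auto simp: Beta_def intro!: divide_nonneg_nonneg
        mult_nonneg_nonneg less_imp_le[OF Gamma_real_pos])
    have "\<bar>Gamma \<gamma> * w t0\<bar> \<le> (A * f t0) * exp (L * t0) * (L powr (- \<gamma> / 2) *
        (t0 powr (\<gamma> / 2) * Beta 1 (\<gamma> / 2)))"
      unfolding e[OF that(1), symmetric] using t0 f0[of t0]
      by (intro weighted_kernel_bound[OF \<gamma>(1,2) L(3) that(1)] lin[OF _ \<gamma>(3,4)]) (auto simp: A_def)
    also have "\<dots> \<le> (A * f t0) * exp (L * t0) * (L powr (- \<gamma> / 2) * (T powr (\<gamma> / 2) * Beta 1
        (\<gamma> / 2)))"
      using t0 f0[of t0] \<gamma> Bp by (intro mult_left_mono mult_right_mono powr_mono2)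
          (auto simp: A_def)
    also have "\<dots> = Gamma \<gamma> * ((f t0 * exp (L * t0)) * q \<gamma> L)" using G by (simp add: q_def)
    finally show ?thesis using G by (simp add: abs_mult)
  qed
  have "f t0 = 0"
  proof (rule ccontr)
    assume ne: "f t0 \<noteq> 0"
    \<comment> \<open>The integral equations hold for positive times only; the zero initial values
      exclude \<open>t0 = 0\<close>.\<close>
    with w0 have "t0 \<noteq> 0" by (auto simp: f_def)
    with t0 have pos: "t0 > 0" by simp
    have "\<bar>w1 t0\<bar> \<le> (f t0 * exp (L * t0)) * q \<alpha> L"
      by (rule step[OF pos \<alpha> _ _ e1]) (auto simp: A_def)
    moreover have "\<bar>w2 t0\<bar> \<le> (f t0 * exp (L * t0)) * q \<beta> L"
      by (rule step[OF pos \<beta> _ _ e2]) (auto simp: A_def)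
    ultimately have "\<bar>w1 t0\<bar> + \<bar>w2 t0\<bar> \<le> (f t0 * exp (L * t0)) * (q \<alpha> L + q \<beta> L)"
      by (simp add: distrib_left)
    also have "\<dots> < (f t0 * exp (L * t0)) * 1"
      using L ne f0[of t0] by (intro mult_strict_left_mono) auto
    also have "\<dots> = \<bar>w1 t0\<bar> + \<bar>w2 t0\<bar>" by (simp add: f_def flip: exp_add)
    finally show False by simp
  qed
  then show ?thesis using wle[of T] t by auto
qed

text \<open>Differences of solutions satisfy the homogeneous Abel system with zero initial values.
  The fact \<open>int\<close> treats one generic component and serves both.\<close>

lemma mixed_index_solution_unique:
  assumes \<alpha>: "0 < \<alpha>" "\<alpha> \<le> 1" and \<beta>: "0 < \<beta>" "\<beta> \<le> 1"
    and y: "mixed_index_solution \<alpha> \<beta> a1 a2 b1 b2 y10 y20 y1 y2"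
    and z: "mixed_index_solution \<alpha> \<beta> a1 a2 b1 b2 y10 y20 z1 z2" and t: "t > 0"
  shows "y1 t = z1 t \<and> y2 t = z2 t"
proof -
  have int: "(LINT s:{0<..<t}|lborel. (t - s) powr (\<gamma> - 1) * (a * (u1 s - v1 s) + b *
      (u2 s - v2 s))) = Gamma \<gamma> * (u t - v t)"
    if \<gamma>: "0 < \<gamma>" "\<gamma> \<le> 1" and t: "t > 0" and c: "continuous_on {0..} u1" "continuous_on {0..}
        u2" "continuous_on {0..} v1" "continuous_on {0..} v2"
       "continuous_on {0..} u" "continuous_on {0..} v" and uv: "u 0 = v 0"
      and u: "\<And>t. t > 0 \<Longrightarrow> caputo_differentiable \<gamma> u t" "\<And>t. t > 0 \<Longrightarrow> caputo_deriv \<gamma> u t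
          = a * u1 t + b * u2 t"
      and v: "\<And>t. t > 0 \<Longrightarrow> caputo_differentiable \<gamma> v t" "\<And>t. t > 0 \<Longrightarrow> caputo_deriv \<gamma> v t
          = a * v1 t + b * v2 t"
    for \<gamma> t a b u1 u2 v1 v2 u v
  proof -
    have cc: "continuous_on {0..} (\<lambda>t. a * u1 t + b * u2 t)" "continuous_on {0..}
        (\<lambda>t. a * v1 t + b * v2 t)"
      by (intro continuous_intros c)+
    have "Gamma \<gamma> * (u t - v t) = Gamma \<gamma> * (u t - u 0) - Gamma \<gamma> * (v t - v 0)"
      using uv by (simp add: algebra_simps)
    also have "\<dots> = (LINT s:{0<..<t}|lborel. (t - s) powr (\<gamma> - 1) * (a * u1 s + b * u2 s)) -
        (LINT s:{0<..<t}|lborel. (t - s) powr (\<gamma> - 1) * (a * v1 s + b * v2 s))"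
      by (simp only: caputo_imp_integral_equation[OF \<gamma> c(5) u cc(1) t]
          caputo_imp_integral_equation[OF \<gamma> c(6) v cc(2) t])
    also have "\<dots> = (LINT s:{0<..<t}|lborel. (t - s) powr (\<gamma> - 1) * (a * u1 s + b * u2 s) -
        (t - s) powr (\<gamma> - 1) * (a * v1 s + b * v2 s))"
      by (intro set_integral_diff(2)[symmetric] set_integrable_powr_kernel_mult \<gamma> t cc)
    finally show ?thesis by (simp add: algebra_simps)
  qed
  have "y1 t - z1 t = 0 \<and> y2 t - z2 t = 0"
    using y z unfolding mixed_index_solution_def
    by (intro abel_system_unique[OF \<alpha> \<beta>, of "\<lambda>t. y1 t - z1 t" "\<lambda>t. y2 t - z2 t" a1 a2 b1 b2 t]
        continuous_intros int \<alpha> \<beta> t) auto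
  then show ?thesis by simp
qed

subsection \<open>Power series solutions\<close>

text \<open>\<open>Y\<close> is an entire function of \<open>t powr \<mu>\<close>, so it is
  differentiated termwise. Each power is then mapped by a Beta integral, and absolute summability
  lets sum and integral be exchanged.\<close>

lemma caputo_power_series:
  fixes d :: "nat \<Rightarrow> real" and \<mu> \<gamma> :: real
  assumes \<mu>: "\<mu> > 0" and \<gamma>: "0 < \<gamma>" "\<gamma> \<le> 1" and R: "R > 0" and d: "\<And>l. \<bar>d l\<bar> \<le> C * R ^ l"
  defines "Y \<equiv> \<lambda>t. \<Sum>l. d l / Gamma (\<mu> * real l + 1) * (t powr \<mu>) ^ l"
  assumes t: "t > 0"
  shows "caputo_differentiable \<gamma> Y t"
    and "(\<lambda>l. d (Suc l) / Gamma (\<mu> * real (Suc l) + 1 - \<gamma>) * t powr (\<mu> * real (Suc l) - \<gamma>)) sums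
        caputo_deriv \<gamma> Y t"
proof -
  \<comment> \<open>Coefficients of the derivative: the constant term drops out, and the factor
    \<open>\<mu> * real (Suc l)\<close> is absorbed by the functional equation of Gamma.\<close>
  define b where "b l = d (Suc l) / Gamma (\<mu> * real (Suc l))" for l
  have d': "norm (d (Suc l)) \<le> (C * R) * R ^ l" for l using d[of "Suc l"] by (simp add: mult_ac)
  have summ: "summable (\<lambda>l. norm (d (Suc l) / Gamma (\<mu> * real (Suc l) + \<nu>) * x ^ l))" for \<nu> x
    using summable_geometric_over_Gamma[OF \<mu> R d', of "\<mu> + \<nu>" x] by (simp add: algebra_simps)
  have powr_step: "t powr (\<mu> * real (Suc l) + c) = t powr (\<mu> + c) * (t powr \<mu>) ^ l" if "t > 0"
      for t c :: real and l
    using that by (simp add: powr_powr algebra_simps flip: powr_realpow powr_add)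
  have Y': "(Y has_real_derivative (\<Sum>l. b l * s powr (\<mu> * real (Suc l) - 1))) (at s)"
      if s: "s > 0" for s
  proof -
    define e where "e l = d l / Gamma (\<mu> * real l + 1)" for l
    have "summable (\<lambda>l. e l * x ^ l)" for x
      unfolding e_def
      by (rule summable_norm_cancel)
        (use summable_geometric_over_Gamma[OF \<mu> R, of d C 1 x] d in simp)
    then have P: "((\<lambda>x. \<Sum>l. e l * x ^ l) has_real_derivative (\<Sum>l. diffs e l * x ^ l)) (at x)" for x
      by (intro termdiffs_strong_converges_everywhere)
    have S: "((\<lambda>s. s powr \<mu>) has_real_derivative \<mu> * s powr (\<mu> - 1)) (at s)"
      using s by (auto intro!: derivative_eq_intros)
    have "(Y has_real_derivative (\<Sum>l. diffs e l * (s powr \<mu>) ^ l) * (\<mu> * s powr (\<mu> - 1))) (at s)"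
      using DERIV_chain2[OF P S] by (simp add: Y_def e_def)
    moreover have "b l = diffs e l * \<mu>" for l
    proof -
      have "\<mu> * real (Suc l) > 0" using \<mu> by simp
      then have "\<mu> * real (Suc l) \<notin> \<int>\<^sub>\<le>\<^sub>0" using nonpos_Ints_nonpos by force
      then show ?thesis
        using \<mu> Gamma_plus1[of "\<mu> * real (Suc l)"] by
            (simp add: diffs_def e_def b_def del: of_nat_Suc)
    qed
    then have "(\<Sum>l. b l * s powr (\<mu> * real (Suc l) - 1)) = (\<Sum>l. (diffs e l * (s powr \<mu>) ^ l) *
        (\<mu> * s powr (\<mu> - 1)))"
      using powr_step[of s _ "-1"] s by (simp add: mult_ac)
    moreover have "summable (\<lambda>l. diffs e l * (s powr \<mu>) ^ l)"
      using \<open>\<And>x. summable (\<lambda>l. e l * x ^ l)\<close> by (rule termdiff_converges_all)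
    ultimately show ?thesis by (simp add: suminf_mult2)
  qed
  then have deriv: "deriv Y s = (\<Sum>l. b l * s powr (\<mu> * real (Suc l) - 1))" if "s > 0" for s
    using that by (intro DERIV_imp_deriv)
  have diff: "Y differentiable at s" if "s > 0" for s
    using Y'[OF that] real_differentiable_def by blast
  have bsum: "summable (\<lambda>l. norm (b l * s powr (\<mu> * real (Suc l) - 1)))" if "s > 0" for s
    using summable_mult[OF summ[of 0 "s powr \<mu>"], of "s powr (\<mu> - 1)"] powr_step[of s _ "-1"] that
    by (simp add: b_def abs_mult mult_ac)
  show "caputo_differentiable \<gamma> Y t"
    "(\<lambda>l. d (Suc l) / Gamma (\<mu> * real (Suc l) + 1 - \<gamma>) * t powr (\<mu> * real (Suc l) - \<gamma>)) sums
        caputo_deriv \<gamma> Y t"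
  proof (atomize (full), cases "\<gamma> = 1")
    case True
    then show "caputo_differentiable \<gamma> Y t \<and>
      (\<lambda>l. d (Suc l) / Gamma (\<mu> * real (Suc l) + 1 - \<gamma>) * t powr (\<mu> * real (Suc l) - \<gamma>)) sums
          caputo_deriv \<gamma> Y t"
      using diff[OF t] deriv[OF t] summable_sums[OF summable_norm_cancel[OF bsum[OF t]]]
      by (simp add: caputo_differentiable_def caputo_deriv_def b_def)
  next
    case False
    with \<gamma> have \<gamma>1: "\<gamma> < 1" by simp
    then have \<Gamma>: "Gamma (1 - \<gamma>) > 0" by (intro Gamma_real_pos) simp
    define h where "h l s = indicator {0<..<t} s * (b l * (s powr (\<mu> * real (Suc l) - 1) *
        (t - s) powr (- \<gamma>)))" for l s
    \<comment> \<open>The integral of the power against the weight, with Beta expanded; its first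
      Gamma factor cancels the denominator of \<open>b l\<close>.\<close>
    define w where "w l = t powr (\<mu> * real (Suc l) - \<gamma>) * (Gamma (\<mu> * real (Suc l)) * Gamma
        (1 - \<gamma>) / Gamma (\<mu> * real (Suc l) + 1 - \<gamma>))" for l
    have hi: "integrable lborel (h l)" and hI: "integral\<^sup>L lborel (h l) = b l * w l"
       and hN: "(\<integral>s. norm (h l s) \<partial>lborel) = \<bar>b l\<bar> * w l" for l
    proof -
      have p: "\<mu> * real (Suc l) > 0" using \<mu> by simp
      define k where "k s = indicator {0<..<t} s * (s powr (\<mu> * real (Suc l) - 1) * (t - s) powr
          (- \<gamma>))" for s
      have k: "integrable lborel k" "integral\<^sup>L lborel k = w l"
        using set_integrable_Beta_kernel[OF p, of "1 - \<gamma>" 0 t] LINT_Beta_kernel[OF p, of "1 - \<gamma>"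
            0 t] t \<gamma>1
        by (simp_all add: set_integrable_def set_lebesgue_integral_def k_def[abs_def] w_def Beta_def
            add_diff_eq del: of_nat_Suc)
      have "h l = (\<lambda>s. b l * k s)" "(\<lambda>s. norm (h l s)) = (\<lambda>s. \<bar>b l\<bar> * k s)"
        by (auto simp: h_def k_def fun_eq_iff abs_mult indicator_def)
      with k show "integrable lborel (h l)" "integral\<^sup>L lborel (h l) = b l * w l"
        "(\<integral>s. norm (h l s) \<partial>lborel) = \<bar>b l\<bar> * w l" by simp_all
    qed
    have Gp: "Gamma (\<mu> * real (Suc l)) > 0" for l using \<mu> by (intro Gamma_real_pos) simp
    have bw: "b l * w l = Gamma (1 - \<gamma>) * (d (Suc l) / Gamma (\<mu> * real (Suc l) + 1 - \<gamma>) * t powr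
        (\<mu> * real (Suc l) - \<gamma>))" for l
      using Gp[of l] by (simp add: b_def w_def del: of_nat_Suc)
    have wn: "w l \<ge> 0" for l
    proof -
      have "\<mu> * real (Suc l) > 0" using \<mu> by simp
      then have "Gamma (\<mu> * real (Suc l) + 1 - \<gamma>) > 0" using \<gamma>1 by (intro Gamma_real_pos) linarith
      then show ?thesis using Gp[of l] \<Gamma> by (simp add: w_def del: of_nat_Suc)
    qed
    have sumI: "summable (\<lambda>l. norm (b l * w l))"
      unfolding bw using summable_mult[OF summ[of "1 - \<gamma>" "t powr \<mu>"], of "Gamma
          (1 - \<gamma>) * t powr (\<mu> - \<gamma>)"]
        powr_step[OF t, of _ "- \<gamma>"] \<Gamma> \<gamma>1
      by (simp add: abs_mult mult_ac add_diff_eq)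
    \<comment> \<open>The exchange needs this pointwise absolute summability and, in
      \<open>sumN\<close>, summability of the integrals of the norms.\<close>
    have AEs: "AE s in lborel. summable (\<lambda>l. norm (h l s))"
    proof (rule AE_I2)
      fix s :: real
      show "summable (\<lambda>l. norm (h l s))"
      proof (cases "s \<in> {0<..<t}")
        case True
        then show ?thesis
          using summable_mult2[OF bsum[of s], of "(t - s) powr (- \<gamma>)"] by
              (simp add: h_def abs_mult mult_ac)
      qed (simp add: h_def)
    qed
    have sumN: "summable (\<lambda>l. \<integral>s. norm (h l s) \<partial>lborel)"
      using sumI wn by (simp only: hN) (simp add: abs_mult)
    have hs: "(\<Sum>l. h l s) = indicator {0<..<t} s *\<^sub>R (deriv Y s / (t - s) powr \<gamma>)" for s
    proof (cases "s \<in> {0<..<t}")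
      case True
      then show ?thesis
        using suminf_mult2[OF summable_norm_cancel[OF bsum[of s]], of "(t - s) powr (- \<gamma>)"]
        by (simp add: h_def deriv powr_minus divide_inverse mult_ac)
    qed (simp add: h_def)
    have int: "set_integrable lborel {0<..<t} (\<lambda>s. deriv Y s / (t - s) powr \<gamma>)"
      using integrable_suminf[OF hi AEs sumN] by (simp add: hs set_integrable_def)
    have "(\<lambda>l. b l * w l) sums (LINT s:{0<..<t}|lborel. deriv Y s / (t - s) powr \<gamma>)"
      using sums_integral[OF hi AEs sumN] by (simp add: hs hI set_lebesgue_integral_def)
    from sums_mult[OF this, of "1 / Gamma (1 - \<gamma>)"]
    show "caputo_differentiable \<gamma> Y t \<and>
      (\<lambda>l. d (Suc l) / Gamma (\<mu> * real (Suc l) + 1 - \<gamma>) * t powr (\<mu> * real (Suc l) - \<gamma>)) sums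
          caputo_deriv \<gamma> Y t"
      using False \<gamma>1 int diff \<Gamma>
      by (simp add: caputo_differentiable_def caputo_deriv_def bw)
  qed
qed

lemma continuous_on_power_series_powr:
  fixes d :: "nat \<Rightarrow> real" and \<mu> :: real
  assumes \<mu>: "\<mu> > 0" and R: "R > 0" and d: "\<And>l. \<bar>d l\<bar> \<le> C * R ^ l"
  shows "continuous_on {0..} (\<lambda>t. \<Sum>l. d l / Gamma (\<mu> * real l + 1) * (t powr \<mu>) ^ l)"
proof -
  have "summable (\<lambda>l. d l / Gamma (\<mu> * real l + 1) * x ^ l)" for x
    by (rule summable_norm_cancel)
      (use summable_geometric_over_Gamma[OF \<mu> R, of d C 1 x] d in simp)
  then have P: "((\<lambda>x. \<Sum>l. d l / Gamma (\<mu> * real l + 1) * x ^ l) has_real_derivative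
      (\<Sum>l. diffs (\<lambda>l. d l / Gamma (\<mu> * real l + 1)) l * x ^ l)) (at x)" for x
    by (intro termdiffs_strong_converges_everywhere)
  then have "continuous_on UNIV (\<lambda>x. \<Sum>l. d l / Gamma (\<mu> * real l + 1) * x ^ l)"
    by (intro DERIV_continuous_on[of UNIV]) auto
  moreover have "continuous_on {0..} (\<lambda>t. t powr \<mu>)"
    using \<mu> by (intro continuous_on_powr' continuous_intros) auto
  ultimately show ?thesis by (rule continuous_on_compose2) auto
qed

text \<open>Lowering an exponent by \<open>\<mu> * real K\<close> moves it back by \<open>K\<close>
  indices. The terms with \<open>0 < l < K\<close> would become negative powers of \<open>t\<close>,
  hence \<open>d0\<close>.\<close>

lemma caputo_power_series_shift:
  fixes d :: "nat \<Rightarrow> real" and \<mu> \<gamma> :: real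
  assumes \<mu>: "\<mu> > 0" and \<gamma>: "\<gamma> = \<mu> * real K" "\<gamma> \<le> 1" and K: "K > 0" and R: "R > 0"
      and d: "\<And>l. \<bar>d l\<bar> \<le> C * R ^ l"
    and d0: "\<And>l. 0 < l \<Longrightarrow> l < K \<Longrightarrow> d l = 0"
  defines "Y \<equiv> \<lambda>t. \<Sum>l. d l / Gamma (\<mu> * real l + 1) * (t powr \<mu>) ^ l"
  assumes t: "t > 0"
  shows "caputo_differentiable \<gamma> Y t"
    and "caputo_deriv \<gamma> Y t = (\<Sum>l. d (l + K) / Gamma (\<mu> * real l + 1) * (t powr \<mu>) ^ l)"
proof -
  have \<gamma>0: "0 < \<gamma>" using \<gamma> \<mu> K by simp
  note C = caputo_power_series[where d=d, OF \<mu> \<gamma>0 \<gamma>(2) R d t, folded Y_def]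
  show "caputo_differentiable \<gamma> Y t" using C(1) .
  \<comment> \<open>The series is already indexed by \<open>Suc l\<close>, so only
    \<open>K - 1\<close> terms are left to skip.\<close>
  have "(\<lambda>l. d (Suc (l + (K - 1))) / Gamma (\<mu> * real (Suc (l + (K - 1))) + 1 - \<gamma>) * t powr
      (\<mu> * real (Suc (l + (K - 1))) - \<gamma>)) sums caputo_deriv \<gamma> Y t"
    using C(2) d0 by (subst sums_zero_iff_shift) auto
  moreover have "d (Suc (l + (K - 1))) / Gamma (\<mu> * real (Suc (l + (K - 1))) + 1 - \<gamma>) * t powr
      (\<mu> * real (Suc (l + (K - 1))) - \<gamma>)
     = d (l + K) / Gamma (\<mu> * real l + 1) * (t powr \<mu>) ^ l" for l
    using K t \<gamma>(1) by (simp add: powr_powr algebra_simps flip: powr_realpow)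
  ultimately show "caputo_deriv \<gamma> Y t = (\<Sum>l. d (l + K) / Gamma (\<mu> * real l + 1) * (t powr \<mu>) ^ l)"
    by (simp add: sums_iff)
qed

text \<open>The Caputo derivatives are the shifted series; the recurrences rewrite their
  coefficients, and linearity of the sums gives the right-hand sides.\<close>

lemma mixed_index_solution_power_series:
  fixes d1 d2 :: "nat \<Rightarrow> real"
  assumes \<mu>: "\<mu> > 0" and K: "K > 0" "\<mu> * real K \<le> 1" and L: "L > 0" "\<mu> * real L \<le> 1"
    and R: "R > 0" and d1: "\<And>l. \<bar>d1 l\<bar> \<le> C1 * R ^ l" and d2: "\<And>l. \<bar>d2 l\<bar> \<le> C2 * R ^ l"
    and z1: "\<And>l. 0 < l \<Longrightarrow> l < K \<Longrightarrow> d1 l = 0" and z2: "\<And>l. 0 < l \<Longrightarrow> l < L \<Longrightarrow> d2 l = 0"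
    and r1: "\<And>l. d1 (l + K) = a1 * d1 l + a2 * d2 l" and r2: "\<And>l. d2 (l + L)
        = b1 * d1 l + b2 * d2 l"
  shows "mixed_index_solution (\<mu> * real K) (\<mu> * real L) a1 a2 b1 b2 (d1 0) (d2 0)
     (\<lambda>t. \<Sum>l. d1 l / Gamma (\<mu> * real l + 1) * (t powr \<mu>) ^ l)
     (\<lambda>t. \<Sum>l. d2 l / Gamma (\<mu> * real l + 1) * (t powr \<mu>) ^ l)"
proof -
  have summ: "summable (\<lambda>l. d l / Gamma (\<mu> * real l + 1) * x ^ l)" if "\<And>l. \<bar>d l\<bar> \<le> C * R ^ l"
      for d C x
    by (rule summable_norm_cancel)
      (use summable_geometric_over_Gamma[OF \<mu> R, of d C 1 x] that in simp)
  have lin: "(\<Sum>l. (a * d1 l + b * d2 l) / Gamma (\<mu> * real l + 1) * x ^ l) =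
      a * (\<Sum>l. d1 l / Gamma (\<mu> * real l + 1) * x ^ l) + b * (\<Sum>l. d2 l / Gamma
          (\<mu> * real l + 1) * x ^ l)" for a b x
  proof -
    have "(\<lambda>l. a * (d1 l / Gamma (\<mu> * real l + 1) * x ^ l) + b * (d2 l / Gamma
        (\<mu> * real l + 1) * x ^ l)) sums
      (a * (\<Sum>l. d1 l / Gamma (\<mu> * real l + 1) * x ^ l) + b * (\<Sum>l. d2 l / Gamma
          (\<mu> * real l + 1) * x ^ l))"
      by (intro sums_add sums_mult summable_sums summ[OF d1] summ[OF d2])
    then show ?thesis by (simp add: sums_iff add_divide_distrib distrib_right mult.assoc)
  qed
  \<comment> \<open>At \<open>t = 0\<close> the base \<open>0 powr \<mu>\<close> is 0 and
    \<open>0 ^ 0 = 1\<close>, so only the constant term \<open>d 0 / Gamma 1\<close>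
    survives.\<close>
  have zero: "(\<Sum>l. d l / Gamma (\<mu> * real l + 1) * 0 ^ l) = d 0" for d :: "nat \<Rightarrow> real"
    using powser_zero[of "\<lambda>l. d l / Gamma (\<mu> * real l + 1)"] by simp
  show ?thesis
    unfolding mixed_index_solution_def
    using continuous_on_power_series_powr[OF \<mu> R d1] continuous_on_power_series_powr[OF \<mu> R d2]
      caputo_power_series_shift[where d=d1, OF \<mu> refl K(2,1) R d1 z1]
      caputo_power_series_shift[where d=d2, OF \<mu> refl L(2,1) R d2 z2]
    by (simp add: r1 r2 lin zero del: times_divide_eq_left)
qed

section \<open>Mittag-Leffler sums and the solution formula\<close>

lemma norm_exponential_sum_le:
  fixes A lam :: "nat \<Rightarrow> complex"
  assumes "\<And>j. j \<in> J \<Longrightarrow> norm (lam j) \<le> R"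
  shows "norm (\<Sum>j\<in>J. A j * lam j ^ k) \<le> (\<Sum>j\<in>J. norm (A j)) * R ^ k"
  unfolding sum_distrib_right
  using assms by (intro sum_norm_le) (auto simp: norm_mult norm_power intro!: mult_left_mono
      power_mono)

text \<open>
  The vanishing of the first power sums removes the negative powers of \<open>t\<close>.
\<close>

lemma sum_mittag_leffler:
  fixes A lam :: "nat \<Rightarrow> complex" and \<mu> t :: real and d :: "nat \<Rightarrow> real"
  assumes \<mu>: "\<mu> > 0" and t: "t > 0" and K: "K > 0"
    and c0: "\<And>k. Suc k < K \<Longrightarrow> (\<Sum>j\<in>J. A j * lam j ^ k) = 0"
    and cd: "\<And>l. (\<Sum>j\<in>J. A j * lam j ^ (l + (K - 1))) = of_real (d l)"
  shows "of_real (t powr (\<mu> - \<mu> * real K)) * (\<Sum>j\<in>J. A j * mittag_leffler \<mu> (1 - \<mu> * real K + \<mu>)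
      (lam j * of_real (t powr \<mu>)))
     = of_real (\<Sum>l. d l / Gamma (\<mu> * real l + 1) * (t powr \<mu>) ^ l)"
proof -
  define \<nu> where "\<nu> = 1 - \<mu> * real K + \<mu>"
  define x where "x = t powr \<mu>"
  define c where "c k = (\<Sum>j\<in>J. A j * lam j ^ k)" for k
  have x: "x > 0" using t by (simp add: x_def)
  let ?S = "\<Sum>j\<in>J. A j * mittag_leffler \<mu> \<nu> (lam j * of_real x)"
  have "(\<lambda>k. (lam j * of_real x) ^ k / of_real (Gamma (\<mu> * real k + \<nu>))) sums mittag_leffler \<mu> \<nu>
      (lam j * of_real x)" for j
    unfolding mittag_leffler_def
    using summable_norm_cancel[OF summable_geometric_over_Gamma[OF \<mu>, of "norm
        (lam j) + 1" "\<lambda>k. lam j ^ k" 1 \<nu> "of_real x"]]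
    by (intro summable_sums) (simp add: norm_power power_mono add_nonneg_pos power_mult_distrib)
  then have "(\<lambda>k. \<Sum>j\<in>J. A j * ((lam j * of_real x) ^ k / of_real (Gamma (\<mu> * real k + \<nu>)))) sums ?S"
    by (intro sums_sum sums_mult)
  also have "(\<lambda>k. \<Sum>j\<in>J. A j * ((lam j * of_real x) ^ k / of_real (Gamma (\<mu> * real k + \<nu>)))) =
      (\<lambda>k. c k * of_real (x ^ k / Gamma (\<mu> * real k + \<nu>)))"
    by (simp add: c_def sum_distrib_right sum_divide_distrib power_mult_distrib mult.assoc)
  finally have "(\<lambda>k. c k * of_real (x ^ k / Gamma (\<mu> * real k + \<nu>))) sums ?S" .
  \<comment> \<open>The first \<open>K - 1\<close> power sums vanish by \<open>c0\<close>, so the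
    series may start at index \<open>K - 1\<close>.\<close>
  then have "(\<lambda>l. c (l + (K - 1)) * of_real (x ^ (l + (K - 1)) / Gamma
      (\<mu> * real (l + (K - 1)) + \<nu>))) sums ?S"
    using c0 by (subst sums_zero_iff_shift) (auto simp: c_def)
  from sums_mult[OF this, of "of_real (t powr (\<mu> - \<mu> * real K))"]
  have "(\<lambda>l. complex_of_real (t powr (\<mu> - \<mu> * real K) * (d l * (x ^ (l + (K - 1)) / Gamma
      (\<mu> * real (l + (K - 1)) + \<nu>))))) sums
      (of_real (t powr (\<mu> - \<mu> * real K)) * ?S)"
    by (simp only: c_def cd of_real_mult)
  also have "(\<lambda>l. complex_of_real (t powr (\<mu> - \<mu> * real K) * (d l * (x ^ (l + (K - 1)) / Gamma
      (\<mu> * real (l + (K - 1)) + \<nu>))))) =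
      (\<lambda>l. of_real (d l / Gamma (\<mu> * real l + 1) * x ^ l))"
  proof
    fix l
    \<comment> \<open>The singular prefactor cancels exactly the \<open>K - 1\<close> powers of
      \<open>x\<close> gained by reindexing.\<close>
    have "t powr (\<mu> - \<mu> * real K) * x ^ (K - 1) = t powr (\<mu> - \<mu> * real K) * t powr
        (\<mu> * (real K - 1))"
      using K t by (simp add: x_def powr_powr of_nat_diff flip: powr_realpow)
    also have "\<dots> = 1" using t by (simp add: algebra_simps flip: powr_add)
    finally have 1: "t powr (\<mu> - \<mu> * real K) * x ^ (K - 1) = 1" .
    have 2: "\<mu> * real (l + (K - 1)) + \<nu> = \<mu> * real l + 1"
      using K by (simp add: \<nu>_def of_nat_diff algebra_simps)
    have "t powr (\<mu> - \<mu> * real K) * (d l * (x ^ (l + (K - 1)) / Gamma (\<mu> * real l + 1))) =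
        (t powr (\<mu> - \<mu> * real K) * x ^ (K - 1)) * (d l / Gamma (\<mu> * real l + 1) * x ^ l)"
      by (simp add: power_add)
    then show "complex_of_real (t powr (\<mu> - \<mu> * real K) * (d l * (x ^ (l + (K - 1)) / Gamma
        (\<mu> * real (l + (K - 1)) + \<nu>))))
      = of_real (d l / Gamma (\<mu> * real l + 1) * x ^ l)"
      unfolding 1 2 by (simp only: mult_1_left)
  qed
  finally have *: "(\<lambda>l. complex_of_real (d l / Gamma (\<mu> * real l + 1) * x ^ l)) sums
      (of_real (t powr (\<mu> - \<mu> * real K)) * ?S)" .
  then have "summable (\<lambda>l. complex_of_real (d l / Gamma (\<mu> * real l + 1) * x ^ l))" by
      (rule sums_summable)
  then have "summable (\<lambda>l. d l / Gamma (\<mu> * real l + 1) * x ^ l)" by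
      (simp only: summable_complex_of_real)
  then show ?thesis
    using sums_unique2[OF * sums_of_real[OF summable_sums]] by (simp add: x_def \<nu>_def)
qed

text \<open>Existence is included so that the formula is not vacuous. The formula is restricted to
  positive times: \<open>0 powr x\<close> is 0 for every \<open>x\<close>, so at
  \<open>t = 0\<close> its right-hand side would be 0 whatever the initial value.\<close>

theorem theorem15:
  fixes m n p q N :: nat
    and \<alpha> \<beta> a1 a2 b1 b2 y10 y20 D\<^sub>A :: real
    and Det p1 p2 :: "complex \<Rightarrow> complex"
    and lam A1 A2 :: "nat \<Rightarrow> complex"
  assumes pos: "m > 0" "n > 0" "p > 0" "q > 0"
    and le: "m \<le> n" "p \<le> q"
    and \<alpha>: "\<alpha> = real m / real n" and \<beta>: "\<beta> = real p / real q" and \<alpha>\<beta>: "\<alpha> \<le> \<beta>"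
    and N: "N = m * q + n * p"
    and D\<^sub>A: "D\<^sub>A = a1 * b2 - a2 * b1"
    and Det: "\<And>z. Det z = z ^ (m * q + n * p) - of_real a1 * z ^ (n * p)
                            - of_real b2 * z ^ (m * q) + of_real D\<^sub>A"
    and zeros: "\<And>z. Det z = (\<Prod>j = 1..N. z - lam j)"
    and p1: "\<And>z. p1 z = of_real y10 * z ^ (n * p) + of_real (a2 * y20) * z ^ (n * p - m * q)
                          - of_real (b2 * y10)"
    and p2: "\<And>z. p2 z = of_real y20 * z ^ (n * p) - of_real (a1 * y20) * z ^ (n * p - m * q)
                          + of_real (b1 * y10)"
    and pf1: "\<And>z. Det z \<noteq> 0 \<Longrightarrow> p1 z / Det z = (\<Sum>j = 1..N. A1 j / (z - lam j))"
    and pf2: "\<And>z. Det z \<noteq> 0 \<Longrightarrow> p2 z / Det z = (\<Sum>j = 1..N. A2 j / (z - lam j))"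
  shows "(\<exists>y1 y2. mixed_index_solution \<alpha> \<beta> a1 a2 b1 b2 y10 y20 y1 y2) \<and>
    (\<forall>y1 y2. mixed_index_solution \<alpha> \<beta> a1 a2 b1 b2 y10 y20 y1 y2 \<longrightarrow>
      (\<forall>t>0.
        complex_of_real (y1 t) = of_real (t powr (1 / real (n * q) - \<alpha>)) *
          (\<Sum>j = 1..N. A1 j * mittag_leffler (1 / real (n * q)) (1 - \<alpha> + 1 / real (n * q))
                                (lam j * of_real (t powr (1 / real (n * q))))) \<and>
        complex_of_real (y2 t) = of_real (t powr (1 / real (n * q) - \<alpha>)) *
          (\<Sum>j = 1..N. A2 j * mittag_leffler (1 / real (n * q)) (1 - \<alpha> + 1 / real (n * q))
                                (lam j * of_real (t powr (1 / real (n * q)))))))"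
proof -
  define \<mu> where "\<mu> = 1 / real (n * q)"
  define K where "K = m * q"
  define L where "L = n * p"
  have \<mu>: "\<mu> > 0" using pos by (simp add: \<mu>_def)
  have KL: "K > 0" "L > 0" using pos by (simp_all add: K_def L_def)
  have \<alpha>K: "\<alpha> = \<mu> * real K" and \<beta>L: "\<beta> = \<mu> * real L"
    using pos by (simp_all add: \<alpha> \<beta> \<mu>_def K_def L_def)
  have \<alpha>1: "0 < \<alpha>" "\<alpha> \<le> 1" and \<beta>1: "0 < \<beta>" "\<beta> \<le> 1" using pos le by (simp_all add: \<alpha> \<beta>)
  have KleL: "K \<le> L" using \<alpha>\<beta> \<mu> by (simp add: \<alpha>K \<beta>L)
  \<comment> \<open>A strict bound on all zeros: \<open>Det\<close> does not vanish outside this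
    disc, and the power sums grow at most like powers of \<open>R\<close>.\<close>
  define R where "R = 1 + (\<Sum>j=1..N. norm (lam j))"
  have lamR: "norm (lam j) < R" if "j \<in> {1..N}" for j
    using member_le_sum[of j "{1..N}" "\<lambda>j. norm (lam j)"] that by (simp add: R_def)
  have R: "R > 0" by (simp add: R_def add_pos_nonneg sum_nonneg)
  have Det0: "Det z \<noteq> 0" if "norm z > R" for z
    using lamR that by (fastforce simp: zeros)
  have Det': "Det z = z ^ K * z ^ L - of_real a1 * z ^ L - of_real b2 * z ^ K + of_real
      (a1 * b2 - a2 * b1)" for z
    by (simp add: Det K_def L_def power_add D\<^sub>A)
  have zL: "z ^ L = z ^ K * z ^ (L - K)" for z :: complex
    using KleL by (simp flip: power_add)
  \<comment> \<open>The trivial factor \<open>z ^ (K - K)\<close> matches the shape required by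
    \<open>partial_fraction_recurrence\<close>.\<close>
  have eq1: "(z ^ K - of_real a1) * (\<Sum>j=1..N. A1 j / (z - lam j)) - of_real a2 *
      (\<Sum>j=1..N. A2 j / (z - lam j))
      = of_real y10 * z ^ (K - K)"
   and eq2: "(z ^ L - of_real b2) * (\<Sum>j=1..N. A2 j / (z - lam j)) - of_real b1 *
       (\<Sum>j=1..N. A1 j / (z - lam j))
      = of_real y20 * z ^ (L - K)"
    if z: "norm z > R" for z
  proof -
    \<comment> \<open>Cramer's rule: \<open>p1\<close> and \<open>p2\<close> solve the linear system
      whose right-hand side is multiplied by the determinant.\<close>
    have "(z ^ K - of_real a1) * p1 z - of_real a2 * p2 z = of_real y10 * Det z"
      "(z ^ L - of_real b2) * p2 z - of_real b1 * p1 z = of_real y20 * z ^ (L - K) * Det z"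
      unfolding p1 p2 Det' K_def[symmetric] L_def[symmetric] zL by (simp_all add: algebra_simps)
    then show "(z ^ K - of_real a1) * (\<Sum>j=1..N. A1 j / (z - lam j)) - of_real a2 *
        (\<Sum>j=1..N. A2 j / (z - lam j))
      = of_real y10 * z ^ (K - K)"
      "(z ^ L - of_real b2) * (\<Sum>j=1..N. A2 j / (z - lam j)) - of_real b1 * (\<Sum>j=1..N. A1 j /
          (z - lam j))
      = of_real y20 * z ^ (L - K)"
      using Det0[OF z] unfolding pf1[OF Det0[OF z], symmetric] pf2[OF Det0[OF z], symmetric]
      by (simp_all add: field_simps)
  qed
  define c1 where "c1 k = (\<Sum>j=1..N. A1 j * lam j ^ k)" for k
  define c2 where "c2 k = (\<Sum>j=1..N. A2 j * lam j ^ k)" for k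
  have rec1: "c1 (k + K) = of_real a1 * c1 k + of_real a2 * c2 k" for k
    unfolding c1_def c2_def by (rule partial_fraction_recurrence(1)[OF R lamR KL(1) order_refl eq1])
  have init1: "c1 k = (if Suc k = K then of_real y10 else 0)" if "k < K" for k
    unfolding c1_def by (rule partial_fraction_recurrence(2)[OF R lamR KL(1) order_refl eq1 that])
  \<comment> \<open>The parameters of the recurrence lemma are swapped here: the shift is
    \<open>L\<close>, and \<open>K\<close> fixes the position of the initial value.\<close>
  have rec2: "c2 (k + L) = of_real b2 * c2 k + of_real b1 * c1 k" for k
    unfolding c1_def c2_def by (rule partial_fraction_recurrence(1)[OF R lamR KL(1) KleL eq2])
  have init2: "c2 k = (if Suc k = K then of_real y20 else 0)" if "k < L" for k
    unfolding c2_def by (rule partial_fraction_recurrence(2)[OF R lamR KL(1) KleL eq2 that])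
  \<comment> \<open>Zeros and partial fraction coefficients may be complex, but the recurrences and
    initial segments are real, so strong induction makes all power sums real.\<close>
  have real: "c1 k \<in> \<real> \<and> c2 k \<in> \<real>" for k
  proof (induction k rule: less_induct)
    case (less k)
    have "c1 k \<in> \<real>"
    proof (cases "k < K")
      case False
      then show ?thesis using rec1[of "k - K"] less[of "k - K"] KL by
          (auto intro!: Reals_add Reals_mult)
    qed (auto simp: init1)
    moreover have "c2 k \<in> \<real>"
    proof (cases "k < L")
      case False
      then show ?thesis using rec2[of "k - L"] less[of "k - L"] KL by
          (auto intro!: Reals_add Reals_mult)
    qed (auto simp: init2)
    ultimately show ?case ..
  qed
  \<comment> \<open>The offset \<open>K - 1\<close> skips the vanishing power sums, so that
    \<open>d1 0\<close> and \<open>d2 0\<close> are the initial values.\<close>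
  define d1 where "d1 l = Re (c1 (l + (K - 1)))" for l
  define d2 where "d2 l = Re (c2 (l + (K - 1)))" for l
  have cd1: "c1 (l + (K - 1)) = of_real (d1 l)" and cd2: "c2 (l + (K - 1)) = of_real (d2 l)" for l
    using real[of "l + (K - 1)"] by (simp_all add: d1_def d2_def)
  have small: "c1 k = 0" "c2 k = 0" if "Suc k < K" for k
    using that KleL init1[of k] init2[of k] by simp_all
  define C where "C A = (\<Sum>j=1..N. norm (A j)) * R ^ (K - 1)" for A :: "nat \<Rightarrow> complex"
  have bound: "\<bar>Re (\<Sum>j=1..N. A j * lam j ^ (l + (K - 1)))\<bar> \<le> C A * R ^ l" for A l
  proof -
    have "\<bar>Re (\<Sum>j=1..N. A j * lam j ^ (l + (K - 1)))\<bar> \<le> norm (\<Sum>j=1..N. A j * lam j ^ (l + (K - 1)))"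
      by (rule abs_Re_le_cmod)
    also have "\<dots> \<le> (\<Sum>j=1..N. norm (A j)) * R ^ (l + (K - 1))"
      by (rule norm_exponential_sum_le, rule less_imp_le, rule lamR)
    finally show ?thesis by (simp add: C_def power_add mult_ac)
  qed
  define Y where "Y d t = (\<Sum>l. d l / Gamma (\<mu> * real l + 1) * (t powr \<mu>) ^ l)" for d t
  have "mixed_index_solution (\<mu> * real K) (\<mu> * real L) a1 a2 b1 b2 (d1 0) (d2 0) (Y d1) (Y d2)"
    unfolding Y_def[abs_def]
  proof (rule mixed_index_solution_power_series[OF \<mu> KL(1) _ KL(2) _ R])
    show "\<bar>d1 l\<bar> \<le> C A1 * R ^ l" "\<bar>d2 l\<bar> \<le> C A2 * R ^ l" for l
      using bound[of A1 l] bound[of A2 l] by (simp_all add: d1_def d2_def c1_def c2_def)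
    \<comment> \<open>The recurrence leads back from \<open>l + (K - 1)\<close> to
      \<open>l - 1\<close>, where both power sums vanish because \<open>l < K\<close>.\<close>
    show "d1 l = 0" if l: "0 < l" "l < K" for l
    proof -
      define k where "k = l - 1"
      have k: "l + (K - 1) = k + K" "Suc k < K" using l by (auto simp: k_def)
      show ?thesis unfolding d1_def k(1) rec1 by (simp add: small k(2))
    qed
    show "d2 l = 0" if l: "0 < l" "l < L" for l
    \<comment> \<open>Below \<open>L\<close> the sequence \<open>c2\<close> can be nonzero only at
      \<open>K - 1\<close>, excluded by \<open>l > 0\<close>. From \<open>L\<close> on, the
      recurrence leads back to an index below \<open>K - 1\<close>, because
      \<open>l < L\<close>.\<close>
    proof (cases "l + (K - 1) < L")
      case True
      then show ?thesis using init2[OF True] l by (simp add: d2_def)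
    next
      case False
      define k where "k = l + (K - 1) - L"
      have k: "l + (K - 1) = k + L" "Suc k < K" using False l KL by (auto simp: k_def)
      show ?thesis unfolding d2_def k(1) rec2 by (simp add: small k(2))
    qed
    have shift: "l + i + (K - 1) = l + (K - 1) + i" for l i by simp
    show "d1 (l + K) = a1 * d1 l + a2 * d2 l" "d2 (l + L) = b1 * d1 l + b2 * d2 l" for l
      unfolding d1_def d2_def shift rec1 rec2 by simp_all
  qed (use \<alpha>1 \<beta>1 \<alpha>K \<beta>L in simp_all)
  moreover have "d1 0 = y10" "d2 0 = y20"
    using init1[of "K - 1"] init2[of "K - 1"] KL KleL by (simp_all add: d1_def d2_def)
  ultimately have sol: "mixed_index_solution \<alpha> \<beta> a1 a2 b1 b2 y10 y20 (Y d1) (Y d2)"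
    by (simp add: \<alpha>K \<beta>L)
  have formula: "complex_of_real (Y d t) = of_real (t powr (1 / real (n * q) - \<alpha>)) *
          (\<Sum>j = 1..N. A j * mittag_leffler (1 / real (n * q)) (1 - \<alpha> + 1 / real (n * q))
                                (lam j * of_real (t powr (1 / real (n * q)))))"
    if "t > 0" "\<And>k. Suc k < K \<Longrightarrow> (\<Sum>j=1..N. A j * lam j ^ k) = 0"
       "\<And>l. (\<Sum>j=1..N. A j * lam j ^ (l + (K - 1))) = of_real (d l)" for d t A
    using sum_mittag_leffler[OF \<mu> that(1) KL(1) that(2,3)] unfolding Y_def \<alpha>K \<mu>_def[symmetric]
        by simp
  show ?thesis
  proof (intro conjI allI impI)
    show "\<exists>y1 y2. mixed_index_solution \<alpha> \<beta> a1 a2 b1 b2 y10 y20 y1 y2"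
      using sol by blast
  next
    fix y1 y2 t
    assume "mixed_index_solution \<alpha> \<beta> a1 a2 b1 b2 y10 y20 y1 y2" "t > (0 :: real)"
    then have y: "y1 t = Y d1 t" "y2 t = Y d2 t"
      using mixed_index_solution_unique[OF \<alpha>1 \<beta>1 _ sol] by blast+
    show "complex_of_real (y1 t) = of_real (t powr (1 / real (n * q) - \<alpha>)) *
          (\<Sum>j = 1..N. A1 j * mittag_leffler (1 / real (n * q)) (1 - \<alpha> + 1 / real (n * q))
                                (lam j * of_real (t powr (1 / real (n * q)))))"
      unfolding y using small cd1 by (intro formula \<open>t > 0\<close>) (simp_all only: c1_def)
    show "complex_of_real (y2 t) = of_real (t powr (1 / real (n * q) - \<alpha>)) *
          (\<Sum>j = 1..N. A2 j * mittag_leffler (1 / real (n * q)) (1 - \<alpha> + 1 / real (n * q))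
                                (lam j * of_real (t powr (1 / real (n * q)))))"
      unfolding y using small cd2 by (intro formula \<open>t > 0\<close>) (simp_all only: c2_def)
  qed
qed

end
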